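(* Let $F$ be a field. Suppose that $N$ is a reduct of a countable $\omega$-categorical Ramsey structure, let $H=\mathrm{Aut}(N)$, and let $W\subseteq N^{eq}$ be a finite union of $H$-orbits. Suppose that $FW$ does not satisfy the ascending chain condition on $FH$-submodules. Then there exists an infinite (strictly) ascending chain of cyclic $FH$-submodules $X_1<X_2<\cdots$ in $FW$.
   Context: $FW$ is the $F$-vector space with basis $W$, with $H$ acting by extending its permutation action on $W$ linearly. A submodule is cyclic if it is generated by a single element. A reduct $N$ of $M$ is a structure with the same domain as $M$ all of whose $\emptyset$-definable relations are $\emptyset$-definable in $M$; so $\mathrm{Aut}(M)\le\mathrm{Aut}(N)$. $N^{eq}$: the imaginary elements of $N$, i.e. equivalence classes of $\emptyset$-definable equivalence relations $E$ on $\emptyset$-definable subsets $D\subseteq N^n$ ($n\in\mathbb{N}$); $\mathrm{Aut}(N)$ acts on $N^{eq}$. A countably infinite structure $M$ is $\omega$-categorical iff $\mathrm{Aut}(M)$ has finitely many orbits on $M^n$ for all $n$. A Ramsey structure is a countable Fraïssé structure $M$ (locally finite, every isomorphism between finite substructures extends to an automorphism of $M$) whose age (the class of finite structures embeddable in $M$) is a Ramsey class of rigid structures (i.e. with trivial automorphism group). A class $\mathcal{C}$ of finite structures is a Ramsey class if it is closed under isomorphisms and substructures and for all $k\in\mathbb{N}$ and $A\subseteq B\in\mathcal{C}$ there is $B\subseteq C\in\mathcal{C}$ such that for every $k$-colouring of the set $\binom{C}{A}$ of substructures of $C$ isomorphic to $A$ there is a copy $B'$ of $B$ in $C$ such that the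 colouring is constant on $\binom{B'}{A}$. *)

theory Defs
  imports
    Complex_Main
    "HOL-Library.Countable_Set"
    "HOL-Library.Poly_Mapping"
    "HOL-Combinatorics.Permutations"
begin

section \<open>First-order structures\<close>

text \<open>A symbol is a name together with its arity.\<close>

record ('f, 'r) signature =
  Funs :: "('f \<times> nat) set"
  Rels :: "('r \<times> nat) set"

text \<open>
  Only the values of \<open>Fun\<close> and \<open>Rel\<close> on tuples over \<open>Dom\<close>, for symbols of the signature, are
  meaningful; every notion below ignores the other values. Empty structures are allowed.
\<close>

record ('f, 'r, 'a) struct =
  Dom :: "'a set"
  Fun :: "'f \<Rightarrow> 'a list \<Rightarrow> 'a"
  Rel :: "'r \<Rightarrow> 'a list \<Rightarrow> bool"

definition tuples :: "'a set \<Rightarrow> nat \<Rightarrow> 'a list set" where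
  "tuples A n = {xs. set xs \<subseteq> A \<and> length xs = n}"

definition is_structure :: "('f, 'r) signature \<Rightarrow> ('f, 'r, 'a) struct \<Rightarrow> bool" where
  "is_structure L M \<longleftrightarrow> (\<forall>(f, n) \<in> Funs L. \<forall>xs \<in> tuples (Dom M) n. Fun M f xs \<in> Dom M)"

definition embedding ::
  "('f, 'r) signature \<Rightarrow> ('a \<Rightarrow> 'b) \<Rightarrow> ('f, 'r, 'a) struct \<Rightarrow> ('f, 'r, 'b) struct \<Rightarrow> bool" where
  "embedding L h A B \<longleftrightarrow>
     inj_on h (Dom A) \<and> h ` Dom A \<subseteq> Dom B \<and>
     (\<forall>(f, n) \<in> Funs L. \<forall>xs \<in> tuples (Dom A) n. h (Fun A f xs) = Fun B f (map h xs)) \<and>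
     (\<forall>(r, n) \<in> Rels L. \<forall>xs \<in> tuples (Dom A) n. Rel A r xs \<longleftrightarrow> Rel B r (map h xs))"

definition iso ::
  "('f, 'r) signature \<Rightarrow> ('a \<Rightarrow> 'b) \<Rightarrow> ('f, 'r, 'a) struct \<Rightarrow> ('f, 'r, 'b) struct \<Rightarrow> bool" where
  "iso L h A B \<longleftrightarrow> embedding L h A B \<and> h ` Dom A = Dom B"

definition isomorphic ::
  "('f, 'r) signature \<Rightarrow> ('f, 'r, 'a) struct \<Rightarrow> ('f, 'r, 'b) struct \<Rightarrow> bool" where
  "isomorphic L A B \<longleftrightarrow> (\<exists>h. iso L h A B)"

text \<open>
  Automorphisms are normalised to be the identity outside the domain, so that they form a group
  under composition with neutral element \<open>id\<close>.
\<close>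

definition Aut :: "('f, 'r) signature \<Rightarrow> ('f, 'r, 'a) struct \<Rightarrow> ('a \<Rightarrow> 'a) set" where
  "Aut L M = {h. h permutes Dom M \<and> iso L h M M}"

definition substructure ::
  "('f, 'r) signature \<Rightarrow> ('f, 'r, 'a) struct \<Rightarrow> ('f, 'r, 'a) struct \<Rightarrow> bool" where
  "substructure L A B \<longleftrightarrow>
     is_structure L A \<and> is_structure L B \<and> Dom A \<subseteq> Dom B \<and> embedding L id A B"

text \<open>
  A substructure of a given structure is determined by its domain. The domains which occur are the
  subsets closed under the function symbols.
\<close>

definition closed_subset :: "('f, 'r) signature \<Rightarrow> ('f, 'r, 'a) struct \<Rightarrow> 'a set \<Rightarrow> bool" where
  "closed_subset L M S \<longleftrightarrow>
     S \<subseteq> Dom M \<and> (\<forall>(f, n) \<in> Funs L. \<forall>xs \<in> tuples S n. Fun M f xs \<in> S)"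

definition induced :: "('f, 'r, 'a) struct \<Rightarrow> 'a set \<Rightarrow> ('f, 'r, 'a) struct" where
  "induced M S = M\<lparr>Dom := S\<rparr>"

definition locally_finite :: "('f, 'r) signature \<Rightarrow> ('f, 'r, 'a) struct \<Rightarrow> bool" where
  "locally_finite L M \<longleftrightarrow> (\<forall>S. finite S \<and> S \<subseteq> Dom M \<longrightarrow> finite (closed_subset L M hull S))"

section \<open>Definability and reducts\<close>

datatype 'f tm = Var nat | App 'f "'f tm list"

datatype ('f, 'r) fm =
    Eq "'f tm" "'f tm"
  | Atom 'r "'f tm list"
  | Neg "('f, 'r) fm"
  | Conj "('f, 'r) fm" "('f, 'r) fm"
  | Ex nat "('f, 'r) fm"

primrec wf_tm :: "('f, 'r) signature \<Rightarrow> 'f tm \<Rightarrow> bool" where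
  "wf_tm L (Var i) \<longleftrightarrow> True"
| "wf_tm L (App f ts) \<longleftrightarrow> (f, length ts) \<in> Funs L \<and> list_all (wf_tm L) ts"

primrec wf_fm :: "('f, 'r) signature \<Rightarrow> ('f, 'r) fm \<Rightarrow> bool" where
  "wf_fm L (Eq s t) \<longleftrightarrow> wf_tm L s \<and> wf_tm L t"
| "wf_fm L (Atom r ts) \<longleftrightarrow> (r, length ts) \<in> Rels L \<and> list_all (wf_tm L) ts"
| "wf_fm L (Neg \<phi>) \<longleftrightarrow> wf_fm L \<phi>"
| "wf_fm L (Conj \<phi> \<psi>) \<longleftrightarrow> wf_fm L \<phi> \<and> wf_fm L \<psi>"
| "wf_fm L (Ex i \<phi>) \<longleftrightarrow> wf_fm L \<phi>"

primrec fv_tm :: "'f tm \<Rightarrow> nat set" where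
  "fv_tm (Var i) = {i}"
| "fv_tm (App f ts) = \<Union> (set (map fv_tm ts))"

primrec fv_fm :: "('f, 'r) fm \<Rightarrow> nat set" where
  "fv_fm (Eq s t) = fv_tm s \<union> fv_tm t"
| "fv_fm (Atom r ts) = \<Union> (fv_tm ` set ts)"
| "fv_fm (Neg \<phi>) = fv_fm \<phi>"
| "fv_fm (Conj \<phi> \<psi>) = fv_fm \<phi> \<union> fv_fm \<psi>"
| "fv_fm (Ex i \<phi>) = fv_fm \<phi> - {i}"

primrec eval_tm :: "('f, 'r, 'a) struct \<Rightarrow> (nat \<Rightarrow> 'a) \<Rightarrow> 'f tm \<Rightarrow> 'a" where
  "eval_tm M v (Var i) = v i"
| "eval_tm M v (App f ts) = Fun M f (map (eval_tm M v) ts)"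

primrec sat :: "('f, 'r, 'a) struct \<Rightarrow> (nat \<Rightarrow> 'a) \<Rightarrow> ('f, 'r) fm \<Rightarrow> bool" where
  "sat M v (Eq s t) \<longleftrightarrow> eval_tm M v s = eval_tm M v t"
| "sat M v (Atom r ts) \<longleftrightarrow> Rel M r (map (eval_tm M v) ts)"
| "sat M v (Neg \<phi>) \<longleftrightarrow> \<not> sat M v \<phi>"
| "sat M v (Conj \<phi> \<psi>) \<longleftrightarrow> sat M v \<phi> \<and> sat M v \<psi>"
| "sat M v (Ex i \<phi>) \<longleftrightarrow> (\<exists>a \<in> Dom M. sat M (v(i := a)) \<phi>)"

text \<open>Definability is without parameters.\<close>

definition definable ::
  "('f, 'r) signature \<Rightarrow> ('f, 'r, 'a) struct \<Rightarrow> nat \<Rightarrow> 'a list set \<Rightarrow> bool" where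
  "definable L M n R \<longleftrightarrow>
     (\<exists>\<phi>. wf_fm L \<phi> \<and> fv_fm \<phi> \<subseteq> {..<n} \<and> R = {xs \<in> tuples (Dom M) n. sat M (nth xs) \<phi>})"

definition reduct ::
  "('g, 's) signature \<Rightarrow> ('g, 's, 'a) struct \<Rightarrow> ('f, 'r) signature \<Rightarrow> ('f, 'r, 'a) struct \<Rightarrow> bool"
  where
  "reduct L' N L M \<longleftrightarrow>
     is_structure L' N \<and> is_structure L M \<and> Dom N = Dom M \<and>
     (\<forall>n R. definable L' N n R \<longrightarrow> definable L M n R)"

section \<open>Imaginary elements\<close>

text \<open>
  An imaginary is a class of a definable equivalence relation \<open>E\<close>, tagged with \<open>E\<close>: as usual the
  sorts are kept disjoint, also when the same set of tuples is a class of several relations.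
\<close>

type_synonym 'a imaginary = "('a list \<times> 'a list) set \<times> 'a list set"

definition imaginaries ::
  "('f, 'r) signature \<Rightarrow> ('f, 'r, 'a) struct \<Rightarrow> 'a imaginary set" where
  "imaginaries L M =
     {(E, X). \<exists>n D. definable L M n D \<and> equiv D E \<and>
                    definable L M (2 * n) {xs @ ys | xs ys. (xs, ys) \<in> E} \<and> X \<in> D // E}"

definition im_act :: "('a \<Rightarrow> 'a) \<Rightarrow> 'a imaginary \<Rightarrow> 'a imaginary" where
  "im_act h = (\<lambda>(E, X). (E, map h ` X))"

section \<open>\<open>\<omega>\<close>-categorical structures and Ramsey structures\<close>

text \<open>\<open>\<omega>\<close>-categoricity in the form of the Ryll-Nardzewski criterion.\<close>

definition omega_categorical :: "('f, 'r) signature \<Rightarrow> ('f, 'r, 'a) struct \<Rightarrow> bool" where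
  "omega_categorical L M \<longleftrightarrow>
     is_structure L M \<and> countable (Dom M) \<and> infinite (Dom M) \<and>
     (\<forall>n. finite {{map h xs | h. h \<in> Aut L M} | xs. xs \<in> tuples (Dom M) n})"

definition fraisse_structure :: "('f, 'r) signature \<Rightarrow> ('f, 'r, 'a) struct \<Rightarrow> bool" where
  "fraisse_structure L M \<longleftrightarrow>
     is_structure L M \<and> locally_finite L M \<and>
     (\<forall>S T f. finite S \<and> closed_subset L M S \<and> finite T \<and> closed_subset L M T \<and>
              iso L f (induced M S) (induced M T) \<longrightarrow>
              (\<exists>h \<in> Aut L M. \<forall>x \<in> S. h x = f x))"

text \<open>
  The members of the age are taken with domain inside the type of elements of \<open>M\<close>. This is no
  loss for the Ramsey property: members of the age are no larger than \<open>M\<close>, so any finite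
  extension \<open>C\<close> of \<open>B\<close> in the age has a copy over \<open>B\<close> inside this type.
\<close>

definition age :: "('f, 'r) signature \<Rightarrow> ('f, 'r, 'a) struct \<Rightarrow> ('f, 'r, 'a) struct set" where
  "age L M = {A. is_structure L A \<and> finite (Dom A) \<and> (\<exists>h. embedding L h A M)}"

definition copies ::
  "('f, 'r) signature \<Rightarrow> ('f, 'r, 'a) struct \<Rightarrow> ('f, 'r, 'a) struct \<Rightarrow> 'a set set" where
  "copies L C A = {S. closed_subset L C S \<and> isomorphic L A (induced C S)}"

definition ramsey_class :: "('f, 'r) signature \<Rightarrow> ('f, 'r, 'a) struct set \<Rightarrow> bool" where
  "ramsey_class L K \<longleftrightarrow>
     (\<forall>A \<in> K. is_structure L A \<and> finite (Dom A)) \<and>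
     (\<forall>A \<in> K. \<forall>B. is_structure L B \<and> isomorphic L A B \<longrightarrow> B \<in> K) \<and>
     (\<forall>B \<in> K. \<forall>A. substructure L A B \<longrightarrow> A \<in> K) \<and>
     (\<forall>k::nat. \<forall>B \<in> K. \<forall>A. substructure L A B \<longrightarrow>
        (\<exists>C \<in> K. substructure L B C \<and>
           (\<forall>\<chi>. \<chi> ` copies L C A \<subseteq> {..<k} \<longrightarrow>
              (\<exists>B' \<in> copies L C B. \<exists>c. \<forall>S \<in> copies L (induced C B') A. \<chi> S = c))))"

definition ramsey_structure :: "('f, 'r) signature \<Rightarrow> ('f, 'r, 'a) struct \<Rightarrow> bool" where
  "ramsey_structure L M \<longleftrightarrow>
     countable (Dom M) \<and> fraisse_structure L M \<and>
     ramsey_class L (age L M) \<and> (\<forall>A \<in> age L M. Aut L A = {id})"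

section \<open>The permutation module \<open>FW\<close>\<close>

text \<open>The vector space \<open>FW\<close> consists of the finitely supported functions with support in \<open>W\<close>.\<close>

definition FW :: "'w set \<Rightarrow> ('w \<Rightarrow>\<^sub>0 'k::field) set" where
  "FW W = {v. Poly_Mapping.keys v \<subseteq> W}"

definition scale :: "'k::field \<Rightarrow> ('w \<Rightarrow>\<^sub>0 'k) \<Rightarrow> ('w \<Rightarrow>\<^sub>0 'k)" where
  "scale c v = Poly_Mapping.map (\<lambda>a. c * a) v"

lemma lookup_scale [simp]: "Poly_Mapping.lookup (scale c v) w = c * Poly_Mapping.lookup v w"
  by (simp add: scale_def Poly_Mapping.map.rep_eq when_def)

global_interpretation poly: vector_space "scale :: 'k::field \<Rightarrow> ('w \<Rightarrow>\<^sub>0 'k) \<Rightarrow> ('w \<Rightarrow>\<^sub>0 'k)"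
  by unfold_locales (auto intro!: poly_mapping_eqI simp: lookup_add algebra_simps)

definition lin_ext :: "('w \<Rightarrow> 'w) \<Rightarrow> ('w \<Rightarrow>\<^sub>0 'k::field) \<Rightarrow> ('w \<Rightarrow>\<^sub>0 'k)" where
  "lin_ext p v =
     (\<Sum>w \<in> Poly_Mapping.keys v. Poly_Mapping.single (p w) (Poly_Mapping.lookup v w))"

definition FH_submodule ::
  "('a \<Rightarrow> 'a) set \<Rightarrow> 'a imaginary set \<Rightarrow> ('a imaginary \<Rightarrow>\<^sub>0 'k::field) set \<Rightarrow> bool" where
  "FH_submodule H W X \<longleftrightarrow>
     X \<subseteq> FW W \<and> poly.subspace X \<and> (\<forall>h \<in> H. \<forall>v \<in> X. lin_ext (im_act h) v \<in> X)"

definition cyclic_FH_submodule ::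
  "('a \<Rightarrow> 'a) set \<Rightarrow> 'a imaginary set \<Rightarrow> ('a imaginary \<Rightarrow>\<^sub>0 'k::field) set \<Rightarrow> bool" where
  "cyclic_FH_submodule H W X \<longleftrightarrow>
     FH_submodule H W X \<and> (\<exists>v \<in> FW W. X = FH_submodule H W hull {v})"

definition ascending_chain_condition :: "('v set \<Rightarrow> bool) \<Rightarrow> bool" where
  "ascending_chain_condition P \<longleftrightarrow>
     (\<forall>X :: nat \<Rightarrow> 'v set. (\<forall>i. P (X i)) \<and> (\<forall>i. X i \<subseteq> X (Suc i)) \<longrightarrow>
        (\<exists>m. \<forall>n \<ge> m. X n = X m))"

definition finite_union_of_orbits ::
  "('a \<Rightarrow> 'a) set \<Rightarrow> 'a imaginary set \<Rightarrow> bool" where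
  "finite_union_of_orbits H W \<longleftrightarrow>
     (\<exists>T. finite T \<and> W = (\<Union>x \<in> T. {im_act h x | h. h \<in> H}))"

end

theory Submission
  imports Defs
begin

text \<open>
  Let \<open>G = Aut M \<le> H\<close>, and let \<open>K\<close> be the kernel of the map on \<open>FW\<close> that replaces each point of
  \<open>W\<close> by a representative of its \<open>G\<close>-orbit, that is, the space of vectors whose coefficient sums
  over all \<open>G\<close>-orbits vanish. It has finite codimension, so a strictly ascending chain of
  submodules can be taken to grow by elements of \<open>K\<close>. Hence it suffices that for \<open>v\<^sub>1 \<in> FW\<close> and
  \<open>v\<^sub>2 \<in> K\<close> there is \<open>g \<in> G\<close> such that \<open>v\<^sub>1 + g v\<^sub>2\<close> generates both \<open>v\<^sub>1\<close> and \<open>v\<^sub>2\<close>.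

  Let \<open>U \<le> G\<close> be the pointwise stabiliser of a finite support of \<open>v\<^sub>1\<close>. The Ramsey property of \<open>M\<close>,
  applied to the colouring of points by their \<open>U\<close>-orbits, gives \<open>g\<close> such that the coefficient sums
  of \<open>v = g v\<^sub>2\<close> over all \<open>U\<close>-orbits vanish. If \<open>v\<close> were not in the span of the differences
  \<open>u v - v\<close> with \<open>u \<in> U\<close>, there would be a linear functional with value 1 on all translates \<open>u v\<close>;
  a suitable finite colouring of its values contradicts the Ramsey property of \<open>U\<close>. As \<open>u\<close> moves
  \<open>v\<^sub>1 + v\<close> by exactly \<open>u v - v\<close>, the vector \<open>v\<close>, and with it \<open>v\<^sub>1\<close> and \<open>v\<^sub>2\<close>, lies in the submodule
  generated by \<open>v\<^sub>1 + v\<close>.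
\<close>

section \<open>Linear extensions of maps\<close>

lemma subspace_FW: "poly.subspace (FW W)"
  unfolding poly.subspace_def FW_def
  by (auto dest!: subsetD[OF Poly_Mapping.keys_add] simp: in_keys_iff)

lemma keys_subset_FW: "v \<in> FW W \<Longrightarrow> Poly_Mapping.keys v \<subseteq> W"
  by (simp add: FW_def)

lemma lin_ext_superset:
  assumes "finite S" "Poly_Mapping.keys v \<subseteq> S"
  shows "lin_ext p v = (\<Sum>w\<in>S. Poly_Mapping.single (p w) (Poly_Mapping.lookup v w))"
  unfolding lin_ext_def using assms by (intro sum.mono_neutral_left) (auto simp: in_keys_iff)

lemma lin_ext_add: "lin_ext p (u + v) = lin_ext p u + lin_ext p v"
proof -
  let ?S = "Poly_Mapping.keys u \<union> Poly_Mapping.keys v"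
  have "lin_ext p (u + v)
      = (\<Sum>w\<in>?S. Poly_Mapping.single (p w) (Poly_Mapping.lookup (u + v) w))"
    by (rule lin_ext_superset) (simp_all add: Poly_Mapping.keys_add)
  also have "\<dots> = lin_ext p u + lin_ext p v"
    by (simp add: lin_ext_superset[of ?S u] lin_ext_superset[of ?S v]
      lookup_add single_add sum.distrib)
  finally show ?thesis .
qed

lemma lin_ext_scale: "lin_ext p (scale c v) = scale c (lin_ext p v)"
proof -
  have "lin_ext p (scale c v)
      = (\<Sum>w\<in>Poly_Mapping.keys v. Poly_Mapping.single (p w) (Poly_Mapping.lookup (scale c v) w))"
    by (rule lin_ext_superset) (auto simp: in_keys_iff)
  also have "\<dots> = (\<Sum>w\<in>Poly_Mapping.keys v.
      scale c (Poly_Mapping.single (p w) (Poly_Mapping.lookup v w)))"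
    by (intro sum.cong refl poly_mapping_eqI) (simp add: lookup_single when_def)
  finally show ?thesis
    by (simp add: lin_ext_def poly.scale_sum_right)
qed

lemma lin_ext_zero [simp]: "lin_ext p 0 = 0"
  by (simp add: lin_ext_def)

lemma lin_ext_uminus: "lin_ext p (- v) = - lin_ext p v"
  using lin_ext_add[of p v "- v"] by (simp add: eq_neg_iff_add_eq_0 add.commute)

lemma lin_ext_diff: "lin_ext p (u - v) = lin_ext p u - lin_ext p v"
  using lin_ext_add[of p u "- v"] by (simp add: lin_ext_uminus)

lemma lin_ext_sum: "lin_ext p (sum f S) = (\<Sum>i\<in>S. lin_ext p (f i))"
  by (induction S rule: infinite_finite_induct) (auto simp: lin_ext_add)

lemma lin_ext_single [simp]: "lin_ext p (Poly_Mapping.single w c) = Poly_Mapping.single (p w) c"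
  by (auto simp: lin_ext_def)

lemma lin_ext_cong:
  "(\<And>w. w \<in> Poly_Mapping.keys v \<Longrightarrow> p w = q w) \<Longrightarrow> lin_ext p v = lin_ext q v"
  unfolding lin_ext_def by (rule sum.cong) auto

text \<open>Coefficients of points that \<open>q\<close> identifies are added up, so this also
  covers the maps \<open>rep A\<close>, which collapse orbits.\<close>

lemma lin_ext_lin_ext: "lin_ext p (lin_ext q v) = lin_ext (p \<circ> q) v"
  unfolding lin_ext_def[of q v] lin_ext_sum lin_ext_single by (simp add: lin_ext_def)

lemma lin_ext_id: "lin_ext id v = v"
  unfolding lin_ext_def by (rule poly_mapping_eqI)
    (simp add: lookup_sum lookup_single when_def in_keys_iff sum.delta)

lemma keys_lin_ext: "Poly_Mapping.keys (lin_ext p v) \<subseteq> p ` Poly_Mapping.keys v"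
  unfolding lin_ext_def using keys_sum by (fastforce split: if_splits)

lemma lin_ext_mem_FW: "v \<in> FW W \<Longrightarrow> p ` W \<subseteq> W' \<Longrightarrow> lin_ext p v \<in> FW W'"
  using keys_lin_ext[of p v] unfolding FW_def by blast

lemma FW_subset_span:
  "FW (W :: 'w set) \<subseteq> poly.span ((\<lambda>w. Poly_Mapping.single w (1::'k::field)) ` W)"
proof
  fix v :: "'w \<Rightarrow>\<^sub>0 'k" assume v: "v \<in> FW W"
  have "v = (\<Sum>w\<in>Poly_Mapping.keys v. scale (Poly_Mapping.lookup v w) (Poly_Mapping.single w 1))"
    by (rule poly_mapping_eqI)
      (simp add: lookup_sum lookup_single when_def in_keys_iff if_distrib sum.delta cong: if_cong)
  also have "\<dots> \<in> poly.span ((\<lambda>w. Poly_Mapping.single w 1) ` W)"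
    using keys_subset_FW[OF v] by (intro poly.span_sum poly.span_scale poly.span_base) auto
  finally show "v \<in> poly.span ((\<lambda>w. Poly_Mapping.single w 1) ` W)" .
qed

text \<open>Independent subsets of members of the chain have at most \<open>card S\<close> elements.
  One of greatest size, found in some \<open>Y m\<close>, spans every later member.\<close>

lemma (in vector_space) chain_of_subspaces_stabilises:
  fixes Y :: "nat \<Rightarrow> 'b set"
  assumes "\<And>n. subspace (Y n)" and mono: "\<And>m n. m \<le> n \<Longrightarrow> Y m \<subseteq> Y n"
    and "finite S" and Y: "\<And>n. Y n \<subseteq> span S"
  shows "\<exists>m. \<forall>n\<ge>m. Y n = Y m"
proof -
  define P where "P k \<longleftrightarrow> (\<exists>n B. B \<subseteq> Y n \<and> independent B \<and> card B = k)" for k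
  have bound: "finite B \<and> card B \<le> card S" if "B \<subseteq> Y n" "independent B" for B n
    using independent_span_bound[OF \<open>finite S\<close> that(2)] Y that(1) by blast
  have "P 0"
    unfolding P_def by (metis card.empty empty_subsetI independent_empty)
  then obtain k where k: "P k" "\<And>j. P j \<Longrightarrow> j \<le> k"
    using Nat.ex_has_greatest_nat[of P 0 "card S"] bound unfolding P_def by blast
  then obtain m B where B: "B \<subseteq> Y m" "independent B" "card B = k"
    unfolding P_def by auto
  have "Y n \<subseteq> span B" if "n \<ge> m" for n
  proof
    fix y assume y: "y \<in> Y n"
    show "y \<in> span B"
    proof (rule ccontr)
      assume "y \<notin> span B"
      then have "independent (insert y B)" "insert y B \<subseteq> Y n" "y \<notin> B"
        using B y mono[OF that] independent_insertI[of y B] span_base[of y B] by auto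
      then have "P (card (insert y B))"
        unfolding P_def by blast
      moreover have "card (insert y B) = Suc k"
        using bound[OF B(1,2)] B(3) \<open>y \<notin> B\<close> by simp
      ultimately show False
        using k(2) by fastforce
    qed
  qed
  moreover have "span B \<subseteq> Y m"
    using B(1) assms(1) by (rule span_minimal)
  ultimately show ?thesis
    using mono by blast
qed

section \<open>Finite colourings of vector spaces\<close>

context vector_space
begin

text \<open>
  The role of a linear functional that vanishes on \<open>D\<close> and maps \<open>v\<close> to 1, followed by a linear
  projection onto the prime field, is played by a maximal additive subgroup \<open>D'\<close> containing \<open>D\<close>
  and meeting the multiples of \<open>v\<close> only in 0.
\<close>

lemma prime_field_complement:
  assumes D: "subspace D" and v: "v \<notin> D"
  obtains D' where "D \<subseteq> D'" "\<And>x y. x \<in> D' \<Longrightarrow> y \<in> D' \<Longrightarrow> x - y \<in> D'"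
    "\<And>k. of_int k *s v \<in> D' \<Longrightarrow> of_int k = (0::'a)"
    "\<And>x. \<exists>k m. of_int k \<noteq> (0::'a) \<and> of_int k *s x - of_int m *s v \<in> D'"
proof -
  define P where "P = {D'. D \<subseteq> D' \<and> (\<forall>x\<in>D'. \<forall>y\<in>D'. x - y \<in> D') \<and>
      (\<forall>k. of_int k *s v \<in> D' \<longrightarrow> of_int k = (0::'a))}"
  \<comment> \<open>A scalar \<open>of_int k\<close> other than 0 is invertible and would carry
    \<open>v\<close> into \<open>D\<close>; so \<open>D\<close> itself is a candidate.\<close>
  have "of_int k = (0::'a)" if "of_int k *s v \<in> D" for k
  proof (rule ccontr)
    assume k: "of_int k \<noteq> (0::'a)"
    have "inverse (of_int k) *s (of_int k *s v) \<in> D"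
      using subspace_scale[OF D that] .
    with k v show False by simp
  qed
  then have "D \<in> P"
    using D by (auto simp: P_def subspace_diff)
  moreover have "\<Union>C \<in> P" if "C \<noteq> {}" "subset.chain P C" for C
  proof -
    have C: "C \<subseteq> P" "\<And>X Y. X \<in> C \<Longrightarrow> Y \<in> C \<Longrightarrow> X \<subseteq> Y \<or> Y \<subseteq> X"
      using that(2) by (auto simp: subset_chain_def)
    have "x - y \<in> \<Union>C" if xy: "x \<in> \<Union>C" "y \<in> \<Union>C" for x y
    proof -
      obtain X Y where "x \<in> X" "X \<in> C" "y \<in> Y" "Y \<in> C" using xy by auto
      then obtain Z where "Z \<in> C" "x \<in> Z" "y \<in> Z" using C(2) by blast
      then show ?thesis using C(1) by (auto simp: P_def)
    qed
    moreover have "D \<subseteq> \<Union>C"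
    proof -
      obtain X where "X \<in> C" using \<open>C \<noteq> {}\<close> by auto
      moreover then have "D \<subseteq> X" using C(1) by (auto simp: P_def)
      ultimately show ?thesis by auto
    qed
    moreover have "of_int k = (0::'a)" if "of_int k *s v \<in> \<Union>C" for k
      using that C(1) by (auto simp: P_def)
    ultimately show ?thesis
      by (simp add: P_def)
  qed
  ultimately obtain D' where D': "D' \<in> P" and max: "\<And>X. X \<in> P \<Longrightarrow> D' \<subseteq> X \<Longrightarrow> X = D'"
    using subset_Zorn_nonempty[of P] by blast
  have diff: "x - y \<in> D'" if "x \<in> D'" "y \<in> D'" for x y
    using D' that by (auto simp: P_def)
  have zero: "0 \<in> D'"
    using D' subspace_0[OF D] by (auto simp: P_def)
  have indep: "of_int k = (0::'a)" if "of_int k *s v \<in> D'" for k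
    using D' that by (auto simp: P_def)
  have ex: "\<exists>k m. of_int k \<noteq> (0::'a) \<and> of_int k *s x - of_int m *s v \<in> D'" for x
  proof (cases "x \<in> D'")
    case True
    then show ?thesis by (intro exI[of _ 1] exI[of _ 0]) simp
  next
    case False
    \<comment> \<open>This is the subgroup generated by \<open>D'\<close> and \<open>x\<close>. By
      maximality it contains a nonzero multiple of \<open>v\<close>, and the resulting relation must
      involve \<open>x\<close>, as \<open>D'\<close> alone contains no such multiple.\<close>
    define X where "X = {d + of_int k *s x | d k. d \<in> D'}"
    have "d + of_int 0 *s x \<in> X" if "d \<in> D'" for d
      unfolding X_def using that by blast
    then have sub: "D' \<subseteq> X" by auto
    have "0 + of_int 1 *s x \<in> X"
      unfolding X_def using zero by blast
    then have "X \<noteq> D'"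
      using False by auto
    then have "X \<notin> P"
      using max sub by blast
    moreover have "D \<subseteq> X"
      using sub D' by (auto simp: P_def)
    moreover have "y - z \<in> X" if yz: "y \<in> X" "z \<in> X" for y z
    proof -
      obtain d k e l where "y = d + of_int k *s x" "z = e + of_int l *s x" "d \<in> D'" "e \<in> D'"
        using yz by (auto simp: X_def)
      then have "y - z = (d - e) + of_int (k - l) *s x" "d - e \<in> D'"
        by (simp_all add: scale_left_diff_distrib diff)
      then show ?thesis unfolding X_def by blast
    qed
    ultimately obtain m where m: "of_int m *s v \<in> X" "of_int m \<noteq> (0::'a)"
      unfolding P_def by blast
    then obtain d k where dk: "of_int m *s v = d + of_int k *s x" "d \<in> D'"
      by (auto simp: X_def)
    have "of_int k \<noteq> (0::'a)"
      using m(2) dk indep[of m] by auto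
    moreover have "of_int k *s x - of_int m *s v \<in> D'"
      using diff[OF zero dk(2)] dk(1) by simp
    ultimately show ?thesis by blast
  qed
  have "D \<subseteq> D'"
    using D' by (simp add: P_def)
  then show thesis
    using diff indep ex by (rule that)
qed

end

section \<open>Additive subgroups, the characteristic of a field, and residues\<close>

lemma sum_mem_additive_subgroup:
  assumes diff: "\<And>x y. x \<in> D' \<Longrightarrow> y \<in> D' \<Longrightarrow> x - y \<in> D'" and "0 \<in> D'"
    and "\<And>i. i \<in> I \<Longrightarrow> f i \<in> D'"
  shows "sum f I \<in> (D' :: 'b::ab_group_add set)"
proof -
  have add: "x + y \<in> D'" if "x \<in> D'" "y \<in> D'" for x y
    using diff[OF that(1) diff[OF \<open>0 \<in> D'\<close> that(2)]] by simp
  show ?thesis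
    using assms(3) by (induction I rule: infinite_finite_induct) (auto intro: add \<open>0 \<in> D'\<close>)
qed

text \<open>With \<open>d = gcd k ?p\<close> and \<open>?p = d * e\<close>, the factor
  \<open>d\<close> is nonzero in the field, so \<open>e\<close> vanishes there. Then
  \<open>?p\<close> divides \<open>e\<close>, which forces \<open>d = 1\<close>, and the Bezout
  identity supplies the inverse.\<close>

lemma of_int_inverse_mod_char:
  assumes "CHAR('a::field) > 0" and k: "of_int k \<noteq> (0::'a)"
  shows "\<exists>l. of_int l * of_int k = (1::'a)"
proof -
  let ?p = "int CHAR('a)"
  define d where "d = gcd k ?p"
  obtain e where e: "?p = d * e" "d dvd k"
    unfolding d_def by (meson dvd_def gcd_dvd1 gcd_dvd2)
  have "d > 0"
    using assms(1) by (simp add: d_def)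
  then have "e > 0"
    using e(1) assms(1) by (metis of_nat_0_less_iff zero_less_mult_pos)
  have "of_int d \<noteq> (0::'a)"
    using k e(2) by (auto simp: dvd_def)
  moreover have "of_int d * of_int e = (0::'a)"
    using e(1) by (metis of_int_mult of_int_of_nat_eq of_nat_CHAR)
  ultimately have "of_int e = (0::'a)" by simp
  then have "of_nat (nat e) = (0::'a)"
    using \<open>e > 0\<close> by (metis of_int_of_nat_eq order_less_imp_le nat_0_le)
  then have "CHAR('a) dvd nat e"
    by (simp add: of_nat_eq_0_iff_char_dvd)
  then have "?p \<le> e"
    using \<open>e > 0\<close> by (metis dvd_imp_le int_dvd_int_iff nat_0_le order_less_imp_le zdvd_imp_le)
  then have "d = 1"
    using e(1) \<open>e > 0\<close> \<open>d > 0\<close> by (simp add: mult_le_cancel_right1)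
  then obtain l m where "l * k + m * ?p = 1"
    using bezout_int[of k ?p] by (auto simp: d_def)
  then have "of_int (l * k + m * ?p) = (1::'a)" by simp
  then show ?thesis by (intro exI[of _ l]) simp
qed

lemma nat_mod_less: "int p > 0 \<Longrightarrow> nat (a mod int p) < p"
  using pos_mod_bound[of "int p" a] by (metis nat_less_iff pos_mod_sign)

text \<open>The floors differ by some \<open>2 * N * z\<close>, and two rounding errors in [0, 1)
  differ by less than 1.\<close>

lemma floor_mod_close:
  fixes s t :: real and N :: int
  assumes "N > 0" "\<lfloor>s\<rfloor> mod (2 * N) = \<lfloor>t\<rfloor> mod (2 * N)"
  shows "\<exists>z::int. \<bar>s - t - 2 * of_int N * of_int z\<bar> < 1"
proof -
  obtain z where "\<lfloor>s\<rfloor> - \<lfloor>t\<rfloor> = 2 * N * z"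
    using assms(2) by (metis mod_eq_dvd_iff dvd_def)
  then have "of_int \<lfloor>s\<rfloor> - of_int \<lfloor>t\<rfloor> = 2 * real_of_int N * of_int z"
    by (metis of_int_diff of_int_mult of_int_numeral)
  moreover have "of_int \<lfloor>s\<rfloor> \<le> s" "s < of_int \<lfloor>s\<rfloor> + 1" "of_int \<lfloor>t\<rfloor> \<le> t" "t < of_int \<lfloor>t\<rfloor> + 1"
    by linarith+
  ultimately show ?thesis
    by (intro exI[of _ z]) linarith
qed

context vector_space
begin

text \<open>
  In characteristic 0 the space is first mapped to the rationals with \<open>v\<close> going to 1, and then
  coloured by the position modulo 2: differences of points of equal colour are so close to 0
  modulo 2 that a sum of \<open>card I\<close> of them is not 1.
\<close>

lemma finite_coloring_avoiding:
  assumes D: "subspace D" and v: "v \<notin> D" and I: "finite I"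
  shows "\<exists>\<kappa> :: 'b \<Rightarrow> nat. finite (range \<kappa>) \<and>
    (\<forall>x y. (\<forall>i\<in>I. \<kappa> (x i) = \<kappa> (y i)) \<longrightarrow> sum x I - sum y I - v \<notin> D)"
proof -
  obtain D' where sub: "D \<subseteq> D'" and diff: "\<And>x y. x \<in> D' \<Longrightarrow> y \<in> D' \<Longrightarrow> x - y \<in> D'"
    and indep: "\<And>k. of_int k *s v \<in> D' \<Longrightarrow> of_int k = (0::'a)"
    and ex: "\<And>x. \<exists>k m. of_int k \<noteq> (0::'a) \<and> of_int k *s x - of_int m *s v \<in> D'"
    using prime_field_complement[OF D v] by blast
  have zero: "0 \<in> D'"
    using sub subspace_0[OF D] by auto
  have add: "x + y \<in> D'" if "x \<in> D'" "y \<in> D'" for x y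
    using diff[OF that(1) diff[OF zero that(2)]] by simp
  have scale_nat: "of_nat n *s x \<in> D'" if "x \<in> D'" for n x
    using that by (induction n) (auto simp: zero scale_left_distrib add)
  have scale_int: "of_int k *s x \<in> D'" if "x \<in> D'" for k x
    using scale_nat[OF that] diff[OF zero scale_nat[OF that]]
    by (cases k rule: int_cases2) simp_all
  have v': "v \<notin> D'"
    using indep[of 1] by auto
  show ?thesis
  proof (cases "CHAR('a) = 0")
    case False
    let ?p = "int CHAR('a)"
    \<comment> \<open>In positive characteristic the integer coefficient of \<open>x\<close> can be
      inverted, so modulo \<open>D'\<close> every vector is an integer multiple of \<open>v\<close>.
      The residue of that integer serves as colour.\<close>
    have "\<exists>j. x - of_int j *s v \<in> D'" for x
    proof -
      obtain k m where k: "of_int k \<noteq> (0::'a)" "of_int k *s x - of_int m *s v \<in> D'"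
        using ex by blast
      obtain l where l: "of_int l * of_int k = (1::'a)"
        using of_int_inverse_mod_char[OF _ k(1)] False by auto
      have "of_int l *s (of_int k *s x - of_int m *s v) \<in> D'"
        by (rule scale_int[OF k(2)])
      moreover have "of_int l *s (of_int k *s x - of_int m *s v) = x - of_int (l * m) *s v"
        by (simp add: scale_right_diff_distrib l)
      ultimately show ?thesis by metis
    qed
    then have "\<exists>j. \<forall>x. x - of_int (j x) *s v \<in> D'"
      by (intro choice allI)
    then obtain j where j: "\<And>x. x - of_int (j x) *s v \<in> D'" by blast
    define \<kappa> where "\<kappa> x = nat (j x mod ?p)" for x
    have "?p > 0" using False by simp
    then have "\<kappa> x < CHAR('a)" for x
      unfolding \<kappa>_def by (rule nat_mod_less)
    then have "finite (range \<kappa>)"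
      by (auto intro: finite_subset[of _ "{..<CHAR('a)}"])
    moreover have close: "x - y \<in> D'" if "\<kappa> x = \<kappa> y" for x y
    proof -
      have "j x mod ?p = j y mod ?p"
        using that \<open>?p > 0\<close> unfolding \<kappa>_def by (simp only: eq_nat_nat_iff pos_mod_sign)
      then obtain z where "j x - j y = ?p * z"
        by (metis mod_eq_dvd_iff dvd_def)
      then have "of_int (j x - j y) = (0::'a)" by simp
      then have "of_int (j x) *s v = of_int (j y) *s v" by simp
      then show ?thesis
        using diff[OF j[of x] j[of y]] by (simp only: diff_diff_eq2 diff_add_cancel)
    qed
    have "sum x I - sum y I - v \<notin> D" if "\<forall>i\<in>I. \<kappa> (x i) = \<kappa> (y i)" for x y
    proof
      assume "sum x I - sum y I - v \<in> D"
      moreover have "sum x I - sum y I \<in> D'"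
        unfolding sum_subtractf[symmetric]
        by (rule sum_mem_additive_subgroup[OF diff zero]) (use that close in auto)
      ultimately have "(sum x I - sum y I) - (sum x I - sum y I - v) \<in> D'"
        using sub by (blast intro: diff)
      then show False using v' by simp
    qed
    ultimately show ?thesis by blast
  next
    case True
    have of_int_0: "k = 0" if "of_int k = (0::'a)" for k
    proof -
      have "of_nat (nat \<bar>k\<bar>) = (0::'a)"
        using that by (cases k rule: int_cases2) simp_all
      then have "CHAR('a) dvd nat \<bar>k\<bar>"
        by (simp only: of_nat_eq_0_iff_char_dvd)
      then show ?thesis using True by simp
    qed
    \<comment> \<open>Eliminating \<open>x\<close> from the two relations leaves a multiple of
      \<open>v\<close> in \<open>D'\<close>. Hence the ratio of \<open>m\<close> to \<open>k\<close>
      depends on \<open>x\<close> only.\<close>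
    have uniq: "m * k' = m' * k"
      if "of_int k *s x - of_int m *s v \<in> D'" "of_int k' *s x - of_int m' *s v \<in> D'" for k m k' m' x
    proof -
      have "of_int k *s (of_int k' *s x - of_int m' *s v)
          - of_int k' *s (of_int k *s x - of_int m *s v) \<in> D'" (is "?d \<in> D'")
        by (rule diff[OF scale_int[OF that(2)] scale_int[OF that(1)]])
      moreover have "?d = of_int (m * k' - m' * k) *s v"
        by (simp add: algebra_simps)
      ultimately show ?thesis
        using indep[of "m * k' - m' * k"] of_int_0[of "m * k' - m' * k"] by simp
    qed
    obtain k m where km: "\<And>x. of_int (k x) \<noteq> (0::'a)"
      "\<And>x. of_int (k x) *s x - of_int (m x) *s v \<in> D'"
      using ex by metis
    \<comment> \<open>This is the additive map with rational values that is 0 on \<open>D\<close>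
      and 1 at \<open>v\<close>.\<close>
    define q :: "'b \<Rightarrow> real" where "q x = of_int (m x) / of_int (k x)" for x
    have q: "q x = of_int m' / of_int k'"
      if "of_int k' *s x - of_int m' *s v \<in> D'" "k' \<noteq> 0" for x m' k'
    proof -
      have "k x \<noteq> 0" using km(1)[of x] by auto
      moreover have "m x * k' = m' * k x" using uniq[OF km(2) that(1)] .
      then have "real_of_int (m x) * of_int k' = of_int m' * of_int (k x)"
        by (metis of_int_mult)
      ultimately show ?thesis
        using that(2) by (simp add: q_def field_simps)
    qed
    have k0: "k x \<noteq> 0" for x using km(1)[of x] by auto
    have q_diff: "q (x - y) = q x - q y" for x y
    proof -
      have "of_int (k y) *s (of_int (k x) *s x - of_int (m x) *s v)
          - of_int (k x) *s (of_int (k y) *s y - of_int (m y) *s v) \<in> D'" (is "?d \<in> D'")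
        by (rule diff[OF scale_int[OF km(2)] scale_int[OF km(2)]])
      moreover have "?d = of_int (k x * k y) *s (x - y) - of_int (k y * m x - k x * m y) *s v"
        by (simp add: algebra_simps)
      ultimately have "q (x - y) = of_int (k y * m x - k x * m y) / of_int (k x * k y)"
        using k0 by (intro q) auto
      also have "\<dots> = q x - q y"
        using k0 by (simp add: q_def field_simps)
      finally show ?thesis .
    qed
    have q_0: "q 0 = 0" using q_diff[of 0 0] by simp
    have q_add: "q (x + y) = q x + q y" for x y
      using q_diff[of x "- y"] q_diff[of 0 y] q_0 by simp
    have q_sum: "q (sum f I) = (\<Sum>i\<in>I. q (f i))" for f
      using I by (induction I) (auto simp: q_0 q_add)
    have q_D: "q x = 0" if "x \<in> D" for x
      using q[of 1 x 0] that sub by auto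
    have q_v: "q v = 1"
      using q[of 1 v 1] zero by simp
    \<comment> \<open>An interval of length 2 is cut into \<open>2 * N\<close> pieces of length
      \<open>1 / N\<close>. As \<open>N\<close> exceeds \<open>card I\<close>, adding
      \<open>card I\<close> errors below \<open>1 / N\<close> cannot reach 1.\<close>
    define N where "N = int (card I) + 1"
    define \<kappa> where "\<kappa> x = nat (\<lfloor>of_int N * q x\<rfloor> mod (2 * N))" for x
    have N: "N > 0" by (simp add: N_def)
    then have "\<kappa> x < nat (2 * N)" for x
      using nat_mod_less[of "nat (2 * N)"] by (simp add: \<kappa>_def)
    then have "finite (range \<kappa>)"
      by (auto intro: finite_subset[of _ "{..<nat (2 * N)}"])
    moreover have "sum x I - sum y I - v \<notin> D" if xy: "\<forall>i\<in>I. \<kappa> (x i) = \<kappa> (y i)" for x y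
    proof
      assume "sum x I - sum y I - v \<in> D"
      then have "q (sum x I - sum y I - v) = 0" by (rule q_D)
      then have sum1: "(\<Sum>i\<in>I. q (x i) - q (y i)) = 1"
        by (simp add: q_diff q_sum q_v sum_subtractf)
      have "\<exists>z::int. \<bar>of_int N * q (x i) - of_int N * q (y i) - 2 * of_int N * of_int z\<bar> < 1"
        if "i \<in> I" for i
      proof -
        have "\<kappa> (x i) = \<kappa> (y i)" using xy that by blast
        then have "\<lfloor>of_int N * q (x i)\<rfloor> mod (2 * N) = \<lfloor>of_int N * q (y i)\<rfloor> mod (2 * N)"
          using N unfolding \<kappa>_def
          by (simp only: eq_nat_nat_iff pos_mod_sign zero_less_mult_iff zero_less_numeral simp_thms)
        then show ?thesis
          by (rule floor_mod_close[OF N])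
      qed
      then obtain z :: "_ \<Rightarrow> int" where
        z: "\<And>i. i \<in> I \<Longrightarrow> \<bar>of_int N * q (x i) - of_int N * q (y i) - 2 * of_int N * of_int (z i)\<bar> < 1"
        by metis
      \<comment> \<open>The errors add up to \<open>N\<close> times the odd integer
        \<open>1 - 2 * sum z I\<close>, so to at least \<open>N\<close> in absolute value, against
        the bound \<open>card I\<close>. Modulo 1 instead of 2 this factor could be 0.\<close>
      have "(\<Sum>i\<in>I. of_int N * q (x i) - of_int N * q (y i) - 2 * of_int N * of_int (z i))
          = of_int N * (\<Sum>i\<in>I. q (x i) - q (y i)) - 2 * of_int N * of_int (sum z I)"
        by (simp add: sum_subtractf right_diff_distrib sum_distrib_left)
      also have "\<dots> = of_int (N * (1 - 2 * sum z I))"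
        by (simp add: sum1 algebra_simps)
      finally have "\<bar>of_int (N * (1 - 2 * sum z I))\<bar>
          \<le> (\<Sum>i\<in>I. \<bar>of_int N * q (x i) - of_int N * q (y i) - 2 * of_int N * of_int (z i)\<bar>)"
        by (metis sum_abs)
      also have "\<dots> \<le> of_int (int (card I))"
        by (rule order_trans[OF sum_bounded_above[where K = 1]]) (auto intro: less_imp_le z)
      finally have "\<bar>N * (1 - 2 * sum z I)\<bar> \<le> int (card I)"
        by linarith
      moreover have "1 - 2 * sum z I \<noteq> 0"
        by presburger
      then have "N \<le> \<bar>N * (1 - 2 * sum z I)\<bar>"
        using N by (simp add: abs_mult)
      ultimately show False
        by (simp add: N_def)
    qed
    ultimately show ?thesis by blast
  qed
qed

end

section \<open>Permutation modules of Ramsey actions\<close>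

text \<open>\<open>support\<close> says that the action on \<open>W\<close> is continuous for
  pointwise convergence on \<open>\<Omega>\<close>. \<open>ramsey_nat\<close> is the Ramsey property
  in group form, for colourings of \<open>G\<close> that depend only on the restriction to a finite
  set. Colours are natural numbers because a locale assumption cannot quantify over the colour
  type.\<close>

locale ramsey_action =
  fixes G :: "('a \<Rightarrow> 'a) set" and \<Omega> :: "'a set"
    and W :: "'w set" and act :: "('a \<Rightarrow> 'a) \<Rightarrow> 'w \<Rightarrow> 'w"
  assumes id_mem: "id \<in> G"
    and comp_mem: "g \<in> G \<Longrightarrow> h \<in> G \<Longrightarrow> g \<circ> h \<in> G"
    and inverse_ex: "g \<in> G \<Longrightarrow> \<exists>h\<in>G. h \<circ> g = id \<and> g \<circ> h = id"
    and act_mem: "g \<in> G \<Longrightarrow> w \<in> W \<Longrightarrow> act g w \<in> W"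
    and act_id: "w \<in> W \<Longrightarrow> act id w = w"
    and act_comp: "g \<in> G \<Longrightarrow> h \<in> G \<Longrightarrow> w \<in> W \<Longrightarrow> act (g \<circ> h) w = act g (act h w)"
    and support: "w \<in> W \<Longrightarrow> \<exists>B. finite B \<and> B \<subseteq> \<Omega> \<and>
      (\<forall>g\<in>G. \<forall>h\<in>G. (\<forall>b\<in>B. g b = h b) \<longrightarrow> act g w = act h w)"
    and finite_orbits: "finite A \<Longrightarrow> A \<subseteq> \<Omega> \<Longrightarrow>
      finite ((\<lambda>w. (\<lambda>g. act g w) ` {g \<in> G. \<forall>a\<in>A. g a = a}) ` W)"
    and ramsey_nat: "finite A \<Longrightarrow> A \<subseteq> \<Omega> \<Longrightarrow> finite T \<Longrightarrow> T \<subseteq> G \<Longrightarrow> finite (\<chi> ` G) \<Longrightarrow>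
      (\<And>g h. g \<in> G \<Longrightarrow> h \<in> G \<Longrightarrow> (\<And>a. a \<in> A \<Longrightarrow> g a = h a) \<Longrightarrow> \<chi> g = (\<chi> h :: nat)) \<Longrightarrow>
      \<exists>g\<in>G. \<forall>t\<in>T. \<chi> (g \<circ> t) = \<chi> g"
begin

section \<open>Stabilisers, orbits and orbit representatives\<close>

definition stab :: "'a set \<Rightarrow> ('a \<Rightarrow> 'a) set" where
  "stab A = {g \<in> G. \<forall>a\<in>A. g a = a}"

definition orb :: "'a set \<Rightarrow> 'w \<Rightarrow> 'w set" where
  "orb A w = (\<lambda>g. act g w) ` stab A"

text \<open>The choice depends on the orbit alone, so within \<open>W\<close> the map
  \<open>rep A\<close> is constant on \<open>stab A\<close>-orbits, and
  \<open>lin_ext (rep A)\<close> records the coefficient sums over them.\<close>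

definition rep :: "'a set \<Rightarrow> 'w \<Rightarrow> 'w" where
  "rep A w = (SOME y. y \<in> orb A w)"

lemma stab_subset: "stab A \<subseteq> G"
  by (auto simp: stab_def)

lemma stab_empty: "stab {} = G"
  by (auto simp: stab_def)

lemma id_mem_stab: "id \<in> stab A"
  by (auto simp: stab_def id_mem)

lemma comp_mem_stab: "g \<in> stab A \<Longrightarrow> h \<in> stab A \<Longrightarrow> g \<circ> h \<in> stab A"
  by (auto simp: stab_def comp_mem)

lemma inverse_ex_stab:
  assumes "g \<in> stab A"
  shows "\<exists>h\<in>stab A. h \<circ> g = id \<and> g \<circ> h = id"
proof -
  obtain h where h: "h \<in> G" "h \<circ> g = id" "g \<circ> h = id"
    using inverse_ex assms by (auto simp: stab_def)
  have "h a = a" if "a \<in> A" for a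
    using that assms h(2) by (auto simp: stab_def dest: fun_cong[of _ _ a])
  then show ?thesis
    using h by (auto simp: stab_def)
qed

lemma orb_subset: "w \<in> W \<Longrightarrow> orb A w \<subseteq> W"
  using act_mem stab_subset by (auto simp: orb_def)

lemma self_mem_orb: "w \<in> W \<Longrightarrow> w \<in> orb A w"
  using act_id id_mem_stab by (force simp: orb_def)

lemma orb_act:
  assumes g: "g \<in> stab A" and w: "w \<in> W"
  shows "orb A (act g w) = orb A w"
proof -
  obtain g' where g': "g' \<in> stab A" "g' \<circ> g = id"
    using inverse_ex_stab[OF g] by blast
  have comp: "act h (act k w) = act (h \<circ> k) w" if "h \<in> stab A" "k \<in> stab A" for h k
    using act_comp[of h k w] that w by (simp add: stab_def)
  have "act h w \<in> orb A (act g w)" if h: "h \<in> stab A" for h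
  proof -
    have "act (h \<circ> g') (act g w) = act ((h \<circ> g') \<circ> g) w"
      by (rule comp) (simp_all add: h g' g comp_mem_stab)
    also have "(h \<circ> g') \<circ> g = h"
      by (simp add: comp_assoc g')
    finally have "act (h \<circ> g') (act g w) = act h w" .
    then show ?thesis
      unfolding orb_def using comp_mem_stab[OF h g'(1)] by (metis image_eqI)
  qed
  moreover have "act h (act g w) \<in> orb A w" if h: "h \<in> stab A" for h
    using comp[OF h g] comp_mem_stab[OF h g] unfolding orb_def by auto
  ultimately show ?thesis
    unfolding orb_def[of A "act g w"] orb_def[of A w] by (auto simp: orb_def)
qed

lemma rep_mem_orb: "w \<in> W \<Longrightarrow> rep A w \<in> orb A w"
  unfolding rep_def using self_mem_orb by (rule someI)

lemma rep_mem: "w \<in> W \<Longrightarrow> rep A w \<in> W"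
  using rep_mem_orb orb_subset by blast

lemma rep_ex:
  assumes w: "w \<in> W"
  obtains t where "t \<in> stab A" "act t (rep A w) = w"
proof -
  obtain g where g: "g \<in> stab A" "rep A w = act g w"
    using rep_mem_orb[OF w] by (auto simp: orb_def)
  have "w \<in> orb A (rep A w)"
    using self_mem_orb[OF w] orb_act[OF g(1) w] g(2) by simp
  with that show thesis
    by (auto simp: orb_def)
qed

lemma finite_rep: "finite A \<Longrightarrow> A \<subseteq> \<Omega> \<Longrightarrow> finite (rep A ` W)"
proof -
  assume "finite A" "A \<subseteq> \<Omega>"
  then have "finite (orb A ` W)"
    using finite_orbits[of A] by (simp add: orb_def[abs_def] stab_def)
  moreover have "rep A ` W = (\<lambda>X. SOME y. y \<in> X) ` orb A ` W"
    by (auto simp: rep_def)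
  ultimately show ?thesis by simp
qed

section \<open>Colourings of \<open>G\<close>, of stabilisers and of points of
  \<open>W\<close>\<close>

lemma ramsey:
  fixes \<chi> :: "('a \<Rightarrow> 'a) \<Rightarrow> 'c"
  assumes "finite A" "A \<subseteq> \<Omega>" "finite T" "T \<subseteq> G" "finite (\<chi> ` G)"
    and \<chi>: "\<And>g h. g \<in> G \<Longrightarrow> h \<in> G \<Longrightarrow> (\<And>a. a \<in> A \<Longrightarrow> g a = h a) \<Longrightarrow> \<chi> g = \<chi> h"
  shows "\<exists>g\<in>G. \<forall>t\<in>T. \<chi> (g \<circ> t) = \<chi> g"
proof -
  obtain f :: "'c \<Rightarrow> nat" where f: "inj_on f (\<chi> ` G)"
    using finite_imp_inj_to_nat_seg[OF assms(5)] by blast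
  have "\<exists>g\<in>G. \<forall>t\<in>T. f (\<chi> (g \<circ> t)) = f (\<chi> g)"
  proof (rule ramsey_nat[OF assms(1-4)])
    show "finite ((\<lambda>g. f (\<chi> g)) ` G)"
      using finite_imageI[OF assms(5), of f] by (simp add: image_image)
    show "f (\<chi> g) = f (\<chi> h)" if "g \<in> G" "h \<in> G" "\<And>a. a \<in> A \<Longrightarrow> g a = h a" for g h
      using \<chi>[OF that] by simp
  qed
  then obtain g where g: "g \<in> G" "\<And>t. t \<in> T \<Longrightarrow> f (\<chi> (g \<circ> t)) = f (\<chi> g)" by blast
  have "\<chi> (g \<circ> t) = \<chi> g" if "t \<in> T" for t
    using g comp_mem[of g t] assms(4) that by (intro inj_onD[OF f]) auto
  with g(1) show ?thesis by blast
qed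

text \<open>
  Colourings of the stabiliser of \<open>A\<close> are lifted to \<open>G\<close> by means of a section \<open>s\<close> of the
  restriction to \<open>A\<close>: the element \<open>g\<close> receives the colour of \<open>s g\<^sup>-\<^sup>1 \<circ> g\<close>.
\<close>

lemma ramsey_stab:
  fixes \<chi> :: "('a \<Rightarrow> 'a) \<Rightarrow> 'c"
  assumes A: "finite A" "A \<subseteq> \<Omega>" and B: "finite B" "B \<subseteq> \<Omega>" and T: "finite T" "T \<subseteq> stab A"
    and fin: "finite (\<chi> ` stab A)"
    and \<chi>: "\<And>g h. g \<in> stab A \<Longrightarrow> h \<in> stab A \<Longrightarrow> (\<And>b. b \<in> B \<Longrightarrow> g b = h b) \<Longrightarrow> \<chi> g = \<chi> h"
  shows "\<exists>g\<in>stab A. \<forall>t\<in>T. \<chi> (g \<circ> t) = \<chi> g"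
proof -
  define s where "s g = (SOME h. h \<in> G \<and> (\<forall>a\<in>A. h a = g a))" for g
  have s: "s g \<in> G \<and> (\<forall>a\<in>A. s g a = g a)" if "g \<in> G" for g
    unfolding s_def by (rule someI[of _ g]) (use that in auto)
  \<comment> \<open>The choice is made from a set determined by \<open>g\<close> on
    \<open>A\<close>, so the chosen functions are equal everywhere. This gives
    \<open>s (g \<circ> t) = s g\<close> for \<open>t\<close> in \<open>stab A\<close>.\<close>
  have s_cong: "s g = s h" if "\<And>a. a \<in> A \<Longrightarrow> g a = h a" for g h
    using that unfolding s_def by (metis (no_types, lifting))
  obtain i where i: "\<And>g. g \<in> G \<Longrightarrow> i g \<in> G \<and> i g \<circ> g = id \<and> g \<circ> i g = id"
    using inverse_ex by metis
  define r where "r g = i (s g) \<circ> g" for g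
  have r: "r g \<in> stab A" if "g \<in> G" for g
  proof -
    have "i (s g) (g a) = a" if "a \<in> A" for a
      using s[OF \<open>g \<in> G\<close>] i[of "s g"] that by (metis comp_apply id_apply)
    then show ?thesis
      unfolding r_def stab_def using comp_mem i s that by auto
  qed
  have "\<exists>g\<in>G. \<forall>t\<in>T. \<chi> (r (g \<circ> t)) = \<chi> (r g)"
  proof (rule ramsey[of "A \<union> B"])
    show "finite ((\<lambda>g. \<chi> (r g)) ` G)"
      using r by (intro finite_subset[OF _ fin]) auto
    show "\<chi> (r g) = \<chi> (r h)" if "g \<in> G" "h \<in> G" "\<And>a. a \<in> A \<union> B \<Longrightarrow> g a = h a" for g h
    proof (rule \<chi>)
      show "r g b = r h b" if "b \<in> B" for b
        using \<open>\<And>a. a \<in> A \<union> B \<Longrightarrow> g a = h a\<close> s_cong[of g h] that by (simp add: r_def)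
    qed (use r that in auto)
  qed (use A B T in \<open>auto simp: stab_def\<close>)
  then obtain g where g: "g \<in> G" "\<And>t. t \<in> T \<Longrightarrow> \<chi> (r (g \<circ> t)) = \<chi> (r g)"
    by blast
  have "r (g \<circ> t) = r g \<circ> t" if "t \<in> T" for t
  proof -
    have "s (g \<circ> t) = s g"
      using T(2) that by (intro s_cong) (auto simp: stab_def)
    then show ?thesis
      by (simp add: r_def comp_assoc)
  qed
  then show ?thesis
    using g r by (metis)
qed

text \<open>Each \<open>w\<close> is \<open>act (t w) (rep A w)\<close> with \<open>t w\<close> in
  \<open>stab A\<close>, so \<open>act g w\<close> is the image of \<open>rep A w\<close> under
  \<open>g \<circ> t w\<close>. Colouring \<open>g\<close> by all values
  \<open>\<kappa> w (act g (rep A w))\<close> at once reduces the claim to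
  \<open>ramsey_stab\<close>; by \<open>support\<close> this colouring depends on \<open>g\<close>
  at finitely many points only.\<close>

lemma ramsey_points:
  fixes \<kappa> :: "'w \<Rightarrow> 'w \<Rightarrow> 'c"
  assumes A: "finite A" "A \<subseteq> \<Omega>" and S: "finite S" "S \<subseteq> W"
    and fin: "\<And>w. w \<in> S \<Longrightarrow> finite (\<kappa> w ` W)"
  shows "\<exists>g\<in>stab A. \<forall>w\<in>S. \<kappa> w (act g w) = \<kappa> w (act g (rep A w))"
proof -
  have "\<exists>t. \<forall>w\<in>S. t w \<in> stab A \<and> act (t w) (rep A w) = w"
    using S rep_ex[of _ A] by (intro bchoice) (metis subsetD)
  then obtain t where t: "\<And>w. w \<in> S \<Longrightarrow> t w \<in> stab A" "\<And>w. w \<in> S \<Longrightarrow> act (t w) (rep A w) = w"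
    by blast
  have "\<exists>B. \<forall>w\<in>S. finite (B w) \<and> B w \<subseteq> \<Omega> \<and>
      (\<forall>g\<in>G. \<forall>h\<in>G. (\<forall>b\<in>B w. g b = h b) \<longrightarrow> act g (rep A w) = act h (rep A w))"
    using S support[OF rep_mem[of _ A]] by (intro bchoice) blast
  then obtain B where B: "\<And>w. w \<in> S \<Longrightarrow> finite (B w)" "\<And>w. w \<in> S \<Longrightarrow> B w \<subseteq> \<Omega>"
    "\<And>w g h. w \<in> S \<Longrightarrow> g \<in> G \<Longrightarrow> h \<in> G \<Longrightarrow> (\<And>b. b \<in> B w \<Longrightarrow> g b = h b) \<Longrightarrow>
      act g (rep A w) = act h (rep A w)"
    by metis
  define \<chi> where "\<chi> g = (\<lambda>w\<in>S. \<kappa> w (act g (rep A w)))" for g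
  have "\<exists>g\<in>stab A. \<forall>u\<in>t ` S. \<chi> (g \<circ> u) = \<chi> g"
  proof (rule ramsey_stab[OF A, where B = "\<Union>w\<in>S. B w"])
    have "\<chi> g \<in> (\<Pi>\<^sub>E w\<in>S. \<kappa> w ` W)" if "g \<in> stab A" for g
      using that S(2) rep_mem act_mem stab_subset unfolding \<chi>_def
      by (intro restrict_PiE_iff[THEN iffD2] ballI imageI) blast
    then show "finite (\<chi> ` stab A)"
      by (intro finite_subset[OF _ finite_PiE[OF S(1) fin]]) auto
    show "\<chi> g = \<chi> h" if "g \<in> stab A" "h \<in> stab A" "\<And>b. b \<in> (\<Union>w\<in>S. B w) \<Longrightarrow> g b = h b" for g h
      unfolding \<chi>_def
    proof (rule restrict_ext)
      fix w assume "w \<in> S"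
      then have "act g (rep A w) = act h (rep A w)"
        using B(3)[of w g h] that stab_subset by blast
      then show "\<kappa> w (act g (rep A w)) = \<kappa> w (act h (rep A w))" by simp
    qed
  qed (use S B t in auto)
  then obtain g where g: "g \<in> stab A" "\<And>w. w \<in> S \<Longrightarrow> \<chi> (g \<circ> t w) = \<chi> g" by blast
  have "\<kappa> w (act g w) = \<kappa> w (act g (rep A w))" if w: "w \<in> S" for w
  proof -
    have "act (g \<circ> t w) (rep A w) = act g (act (t w) (rep A w))"
      using act_comp g(1) t(1)[OF w] rep_mem[of w A] S(2) w stab_subset by blast
    then show ?thesis
      using fun_cong[OF g(2)[OF w], of w] w by (simp add: \<chi>_def t(2)[OF w])
  qed
  with g(1) show ?thesis by blast
qed

section \<open>Vectors with vanishing orbit sums\<close>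

lemma mem_span_differences:
  fixes v :: "'w \<Rightarrow>\<^sub>0 'k::field"
  assumes A: "finite A" "A \<subseteq> \<Omega>" and v: "v \<in> FW W" and zero: "lin_ext (rep A) v = 0"
  shows "v \<in> poly.span ((\<lambda>g. lin_ext (act g) v - v) ` stab A)"
proof (rule ccontr)
  let ?D = "poly.span ((\<lambda>g. lin_ext (act g) v - v) ` stab A)"
  let ?S = "Poly_Mapping.keys v"
  let ?s = "\<lambda>w y. Poly_Mapping.single y (Poly_Mapping.lookup v w)"
  assume "v \<notin> ?D"
  from poly.finite_coloring_avoiding[OF poly.subspace_span this, of ?S]
  obtain \<kappa> :: "_ \<Rightarrow> nat" where \<kappa>: "finite (range \<kappa>)"
    "\<And>x y. (\<And>w. w \<in> ?S \<Longrightarrow> \<kappa> (x w) = \<kappa> (y w)) \<Longrightarrow> sum x ?S - sum y ?S - v \<notin> ?D"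
    by (metis finite_keys)
  \<comment> \<open>The terms \<open>?s w (act g w)\<close> sum to the translate of
    \<open>v\<close>, the terms \<open>?s w (act g (rep A w))\<close> to the translate of
    \<open>lin_ext (rep A) v\<close>, which is 0. Since colours agree term by term, the avoidance
    property denies that \<open>lin_ext (act g) v - v\<close> is in \<open>?D\<close>.\<close>
  have "\<exists>g\<in>stab A. \<forall>w\<in>?S. \<kappa> (?s w (act g w)) = \<kappa> (?s w (act g (rep A w)))"
    by (rule ramsey_points[OF A finite_keys keys_subset_FW[OF v]])
      (rule finite_subset[OF _ \<kappa>(1)], auto)
  then obtain g where g: "g \<in> stab A"
    "\<And>w. w \<in> ?S \<Longrightarrow> \<kappa> (?s w (act g w)) = \<kappa> (?s w (act g (rep A w)))"
    by blast
  have "(\<Sum>w\<in>?S. ?s w (act g w)) - (\<Sum>w\<in>?S. ?s w (act g (rep A w))) - v \<notin> ?D"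
    by (rule \<kappa>(2)) (rule g(2))
  moreover have "(\<Sum>w\<in>?S. ?s w (act g w)) = lin_ext (act g) v"
    by (simp add: lin_ext_def)
  moreover have "(\<Sum>w\<in>?S. ?s w (act g (rep A w))) = lin_ext (act g) (lin_ext (rep A) v)"
    by (simp add: lin_ext_lin_ext) (simp add: lin_ext_def)
  ultimately have "lin_ext (act g) v - v \<notin> ?D"
    by (simp add: zero)
  then show False
    using g(1) by (auto intro: poly.span_base)
qed

text \<open>Points are coloured by their \<open>stab A\<close>-orbits. For the resulting
  \<open>g\<close>, the points \<open>act g w\<close> and \<open>act g (rep {} w)\<close> share such
  an orbit, so the orbit sums of the translate factor through
  \<open>lin_ext (rep {}) v\<close>.\<close>

lemma translate_into_kernel:
  fixes v :: "'w \<Rightarrow>\<^sub>0 'k::field"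
  assumes A: "finite A" "A \<subseteq> \<Omega>" and v: "v \<in> FW W" and zero: "lin_ext (rep {}) v = 0"
  shows "\<exists>g\<in>G. lin_ext (rep A) (lin_ext (act g) v) = 0"
proof -
  let ?S = "Poly_Mapping.keys v"
  have "\<exists>g\<in>stab {}. \<forall>w\<in>?S. rep A (act g w) = rep A (act g (rep {} w))"
    by (rule ramsey_points[OF _ _ finite_keys keys_subset_FW[OF v]]) (auto intro: finite_rep[OF A])
  then obtain g where g: "g \<in> G" "\<And>w. w \<in> ?S \<Longrightarrow> rep A (act g w) = rep A (act g (rep {} w))"
    by (auto simp: stab_empty)
  have "lin_ext (rep A) (lin_ext (act g) v) = lin_ext (\<lambda>x. rep A (act g x)) (lin_ext (rep {}) v)"
    unfolding lin_ext_lin_ext by (rule lin_ext_cong) (simp add: g(2))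
  then show ?thesis
    using g(1) zero by auto
qed

lemma finite_support_FW:
  assumes v: "v \<in> FW W"
  obtains A where "finite A" "A \<subseteq> \<Omega>" "\<And>g. g \<in> stab A \<Longrightarrow> lin_ext (act g) v = v"
proof -
  have "\<exists>B. \<forall>w\<in>Poly_Mapping.keys v. finite (B w) \<and> B w \<subseteq> \<Omega> \<and>
      (\<forall>g\<in>G. \<forall>h\<in>G. (\<forall>b\<in>B w. g b = h b) \<longrightarrow> act g w = act h w)"
    using keys_subset_FW[OF v] support by (intro bchoice) blast
  then obtain B where B: "\<And>w. w \<in> Poly_Mapping.keys v \<Longrightarrow> finite (B w)"
    "\<And>w. w \<in> Poly_Mapping.keys v \<Longrightarrow> B w \<subseteq> \<Omega>"
    "\<And>w g h. w \<in> Poly_Mapping.keys v \<Longrightarrow> g \<in> G \<Longrightarrow> h \<in> G \<Longrightarrow> (\<And>b. b \<in> B w \<Longrightarrow> g b = h b) \<Longrightarrow>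
      act g w = act h w"
    by metis
  show thesis
  proof (rule that)
    show "finite (\<Union>w\<in>Poly_Mapping.keys v. B w)" "(\<Union>w\<in>Poly_Mapping.keys v. B w) \<subseteq> \<Omega>"
      using B by auto
    fix g assume g: "g \<in> stab (\<Union>w\<in>Poly_Mapping.keys v. B w)"
    have "lin_ext (act g) v = lin_ext id v"
    proof (rule lin_ext_cong)
      fix w assume w: "w \<in> Poly_Mapping.keys v"
      have "act g w = act id w"
        using g w by (intro B(3) id_mem) (auto simp: stab_def)
      then show "act g w = id w"
        using act_id keys_subset_FW[OF v] w by auto
    qed
    then show "lin_ext (act g) v = v" by (simp add: lin_ext_id)
  qed
qed

text \<open>\<open>X\<close> ranges over all \<open>G\<close>-stable subspaces, so that submodules
  for any larger group such as \<open>H\<close> are included.\<close>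

lemma combine_generators:
  fixes v\<^sub>1 v\<^sub>2 :: "'w \<Rightarrow>\<^sub>0 'k::field"
  assumes v: "v\<^sub>1 \<in> FW W" "v\<^sub>2 \<in> FW W" and zero: "lin_ext (rep {}) v\<^sub>2 = 0"
  shows "\<exists>g\<in>G. \<forall>X. poly.subspace X \<and> (\<forall>h\<in>G. \<forall>x\<in>X. lin_ext (act h) x \<in> X) \<and>
    v\<^sub>1 + lin_ext (act g) v\<^sub>2 \<in> X \<longrightarrow> v\<^sub>1 \<in> X \<and> v\<^sub>2 \<in> X"
proof -
  obtain A where A: "finite A" "A \<subseteq> \<Omega>" "\<And>g. g \<in> stab A \<Longrightarrow> lin_ext (act g) v\<^sub>1 = v\<^sub>1"
    using finite_support_FW[OF v(1)] by blast
  obtain g where g: "g \<in> G" "lin_ext (rep A) (lin_ext (act g) v\<^sub>2) = 0"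
    using translate_into_kernel[OF A(1,2) v(2) zero] by blast
  let ?v = "lin_ext (act g) v\<^sub>2"
  obtain g' where g': "g' \<in> G" "g' \<circ> g = id"
    using inverse_ex[OF g(1)] by blast
  have recover: "lin_ext (act g') ?v = v\<^sub>2"
  proof -
    have "lin_ext (act g') ?v = lin_ext id v\<^sub>2"
      unfolding lin_ext_lin_ext
    proof (rule lin_ext_cong)
      fix w assume "w \<in> Poly_Mapping.keys v\<^sub>2"
      then have "w \<in> W" using keys_subset_FW[OF v(2)] by blast
      then show "(act g' \<circ> act g) w = id w"
        using act_comp[OF g'(1) g(1), of w] act_id[of w] g'(2) by simp
    qed
    then show ?thesis by (simp add: lin_ext_id)
  qed
  have "?v \<in> FW W"
    using act_mem[OF g(1)] by (intro lin_ext_mem_FW[OF v(2)]) auto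
  then have span: "?v \<in> poly.span ((\<lambda>u. lin_ext (act u) ?v - ?v) ` stab A)"
    using g(2) by (rule mem_span_differences[OF A(1,2)])
  have "v\<^sub>1 \<in> X \<and> v\<^sub>2 \<in> X"
    if X: "poly.subspace X" "\<And>h x. h \<in> G \<Longrightarrow> x \<in> X \<Longrightarrow> lin_ext (act h) x \<in> X" "v\<^sub>1 + ?v \<in> X" for X
  proof -
    have "lin_ext (act u) ?v - ?v \<in> X" if u: "u \<in> stab A" for u
    proof -
      have "lin_ext (act u) (v\<^sub>1 + ?v) \<in> X"
        using u stab_subset by (intro X(2,3)) auto
      from poly.subspace_diff[OF X(1) this X(3)] show ?thesis
        by (simp add: lin_ext_add A(3)[OF u])
    qed
    then have "poly.span ((\<lambda>u. lin_ext (act u) ?v - ?v) ` stab A) \<subseteq> X"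
      by (intro poly.span_minimal X(1)) auto
    then have "?v \<in> X" using span by blast
    then have "lin_ext (act g') ?v \<in> X" "(v\<^sub>1 + ?v) - ?v \<in> X"
      using X g'(1) poly.subspace_diff by blast+
    then show ?thesis by (simp add: recover)
  qed
  with g(1) show ?thesis by blast
qed

text \<open>The images under \<open>lin_ext (rep {})\<close> lie in the span of finitely many
  representatives, so they are constant from some \<open>m\<^sub>0\<close> on. From there a new
  element can be corrected by an element of the smaller subspace with the same image.\<close>

lemma strict_chain_grows_in_kernel:
  fixes X :: "nat \<Rightarrow> ('w \<Rightarrow>\<^sub>0 'k::field) set"
  assumes sub: "\<And>i. poly.subspace (X i)" and W: "\<And>i. X i \<subseteq> FW W"
    and mono: "\<And>i j. i \<le> j \<Longrightarrow> X i \<subseteq> X j" and strict: "\<And>m. \<exists>n\<ge>m. X n \<noteq> X m"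
  shows "\<exists>m\<^sub>0. \<forall>m\<ge>m\<^sub>0. \<exists>n\<ge>m. \<exists>v\<in>X n. v \<notin> X m \<and> lin_ext (rep {}) v = 0"
proof -
  let ?r = "lin_ext (rep {}) :: ('w \<Rightarrow>\<^sub>0 'k) \<Rightarrow> _"
  have "\<exists>m. \<forall>n\<ge>m. ?r ` X n = ?r ` X m"
  proof (rule poly.chain_of_subspaces_stabilises)
    show "poly.subspace (?r ` X n)" for n
      unfolding poly.subspace_def
      using sub[of n] by (auto simp: poly.subspace_def simp flip: lin_ext_add lin_ext_scale
          intro: image_eqI[of _ _ 0])
    show "?r ` X m \<subseteq> ?r ` X n" if "m \<le> n" for m n
      using mono[OF that] by blast
    show "finite ((\<lambda>w. Poly_Mapping.single w (1::'k)) ` rep {} ` W)"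
      using finite_rep[of "{}"] by simp
    show "?r ` X n \<subseteq> poly.span ((\<lambda>w. Poly_Mapping.single w 1) ` rep {} ` W)" for n
      using W[of n] lin_ext_mem_FW[of _ W "rep {}" "rep {} ` W"]
        FW_subset_span[of "rep {} ` W"] by blast
  qed
  then obtain m\<^sub>0 where m\<^sub>0: "\<And>n. n \<ge> m\<^sub>0 \<Longrightarrow> ?r ` X n = ?r ` X m\<^sub>0" by blast
  have "\<exists>n\<ge>m. \<exists>v\<in>X n. v \<notin> X m \<and> ?r v = 0" if "m \<ge> m\<^sub>0" for m
  proof -
    obtain n where n: "n \<ge> m" "X n \<noteq> X m" using strict by blast
    then obtain x where x: "x \<in> X n" "x \<notin> X m" using mono[OF n(1)] by blast
    have "?r x \<in> ?r ` X m"
      using m\<^sub>0[of n] m\<^sub>0[of m] n(1) that x(1) by auto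
    then obtain y where y: "y \<in> X m" "?r x = ?r y" by blast
    then have "?r (x - y) = 0" by (simp add: lin_ext_diff)
    moreover have "x - y \<in> X n"
      using x(1) y(1) mono[OF n(1)] poly.subspace_diff[OF sub[of n]] by blast
    moreover have "x - y \<notin> X m"
    proof
      assume "x - y \<in> X m"
      from poly.subspace_add[OF sub this y(1)] show False using x(2) by simp
    qed
    ultimately show ?thesis using n(1) by blast
  qed
  then show ?thesis by blast
qed

end

section \<open>The Ramsey property of automorphism groups\<close>

lemma map_mem_tuples: "xs \<in> tuples A n \<Longrightarrow> h ` A \<subseteq> B \<Longrightarrow> map h xs \<in> tuples B n"
  by (auto simp: tuples_def)

lemma tuples_mono: "xs \<in> tuples A n \<Longrightarrow> A \<subseteq> B \<Longrightarrow> xs \<in> tuples B n"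
  by (auto simp: tuples_def)

lemma tuples_image:
  assumes "xs \<in> tuples (h ` A) n"
  obtains ys where "ys \<in> tuples A n" "xs = map h ys"
proof
  show "map (inv_into A h) xs \<in> tuples A n"
    using assms by (auto simp: tuples_def inv_into_into)
  show "xs = map h (map (inv_into A h) xs)"
    unfolding map_map using assms
    by (intro map_idI[symmetric]) (auto simp: tuples_def f_inv_into_f subset_iff)
qed

lemma Dom_induced [simp]: "Dom (induced M S) = S"
  and Fun_induced [simp]: "Fun (induced M S) = Fun M"
  and Rel_induced [simp]: "Rel (induced M S) = Rel M"
  by (simp_all add: induced_def)

lemma is_structureD:
  "is_structure L M \<Longrightarrow> (f, n) \<in> Funs L \<Longrightarrow> xs \<in> tuples (Dom M) n \<Longrightarrow> Fun M f xs \<in> Dom M"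
  by (auto simp: is_structure_def)

lemma closed_subsetD:
  "closed_subset L M S \<Longrightarrow> (f, n) \<in> Funs L \<Longrightarrow> xs \<in> tuples S n \<Longrightarrow> Fun M f xs \<in> S"
  by (auto simp: closed_subset_def)

lemma closed_subset_subset: "closed_subset L M S \<Longrightarrow> S \<subseteq> Dom M"
  by (simp add: closed_subset_def)

lemma is_structure_induced: "closed_subset L M S \<Longrightarrow> is_structure L (induced M S)"
  by (auto simp: is_structure_def closed_subset_def)

lemma closed_subset_induced:
  "S' \<subseteq> S \<Longrightarrow> S \<subseteq> Dom M \<Longrightarrow> closed_subset L (induced M S) S' \<longleftrightarrow> closed_subset L M S'"
  by (auto simp: closed_subset_def)

lemma closed_subset_hull:
  assumes "is_structure L M" "S \<subseteq> Dom M"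
  shows "closed_subset L M (closed_subset L M hull S)"
proof -
  have Dom: "closed_subset L M (Dom M)"
    using assms(1) by (auto simp: closed_subset_def is_structure_def)
  have "Fun M f xs \<in> closed_subset L M hull S"
    if "(f, n) \<in> Funs L" "xs \<in> tuples (closed_subset L M hull S) n" for f n xs
    unfolding hull_def
  proof (rule InterI, clarify)
    fix S' assume S': "closed_subset L M S'" "S \<subseteq> S'"
    then have "xs \<in> tuples S' n"
      using that(2) hull_minimal[of S S' "closed_subset L M"] tuples_mono by metis
    then show "Fun M f xs \<in> S'"
      using closed_subsetD[OF S'(1) that(1)] by blast
  qed
  moreover have "closed_subset L M hull S \<subseteq> Dom M"
    using assms(2) Dom by (rule hull_minimal)
  ultimately show ?thesis
    by (auto simp: closed_subset_def)
qed

lemma embeddingD: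
  assumes "embedding L h A B"
  shows "inj_on h (Dom A)" "h ` Dom A \<subseteq> Dom B"
    "\<And>f n xs. (f, n) \<in> Funs L \<Longrightarrow> xs \<in> tuples (Dom A) n \<Longrightarrow> h (Fun A f xs) = Fun B f (map h xs)"
    "\<And>r n xs. (r, n) \<in> Rels L \<Longrightarrow> xs \<in> tuples (Dom A) n \<Longrightarrow> Rel A r xs \<longleftrightarrow> Rel B r (map h xs)"
  using assms by (auto simp: embedding_def)

lemma embeddingI:
  assumes "inj_on h (Dom A)" "h ` Dom A \<subseteq> Dom B"
    "\<And>f n xs. (f, n) \<in> Funs L \<Longrightarrow> xs \<in> tuples (Dom A) n \<Longrightarrow> h (Fun A f xs) = Fun B f (map h xs)"
    "\<And>r n xs. (r, n) \<in> Rels L \<Longrightarrow> xs \<in> tuples (Dom A) n \<Longrightarrow> Rel A r xs \<longleftrightarrow> Rel B r (map h xs)"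
  shows "embedding L h A B"
  using assms by (auto simp: embedding_def)

lemma embedding_id: "embedding L id A A"
  by (rule embeddingI) auto

lemma embedding_comp:
  assumes h: "embedding L h A B" and k: "embedding L k B C"
  shows "embedding L (k \<circ> h) A C"
proof (rule embeddingI)
  note h = embeddingD[OF h] and k = embeddingD[OF k]
  show "inj_on (k \<circ> h) (Dom A)"
    by (rule comp_inj_on[OF h(1) inj_on_subset[OF k(1) h(2)]])
  show "(k \<circ> h) ` Dom A \<subseteq> Dom C"
    using h(2) k(2) by auto
  show "(k \<circ> h) (Fun A f xs) = Fun C f (map (k \<circ> h) xs)"
    if "(f, n) \<in> Funs L" "xs \<in> tuples (Dom A) n" for f n xs
    using h(3)[OF that] k(3)[OF that(1) map_mem_tuples[OF that(2) h(2)]] by simp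
  show "Rel A r xs \<longleftrightarrow> Rel C r (map (k \<circ> h) xs)"
    if "(r, n) \<in> Rels L" "xs \<in> tuples (Dom A) n" for r n xs
    using h(4)[OF that] k(4)[OF that(1) map_mem_tuples[OF that(2) h(2)]] by simp
qed

lemma embedding_cong:
  assumes A: "is_structure L A" and h: "embedding L h A B" and eq: "\<And>x. x \<in> Dom A \<Longrightarrow> h x = k x"
  shows "embedding L k A B"
proof (rule embeddingI)
  note h = embeddingD[OF h]
  have map: "map k xs = map h xs" if "xs \<in> tuples (Dom A) n" for xs n
    using that eq by (auto simp: tuples_def)
  show "inj_on k (Dom A)" "k ` Dom A \<subseteq> Dom B"
    using h(1,2) eq by (auto simp: inj_on_def)
  show "k (Fun A f xs) = Fun B f (map k xs)"
    if "(f, n) \<in> Funs L" "xs \<in> tuples (Dom A) n" for f n xs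
    unfolding map[OF that(2)] using h(3)[OF that] eq[OF is_structureD[OF A that]] by simp
  show "Rel A r xs \<longleftrightarrow> Rel B r (map k xs)"
    if "(r, n) \<in> Rels L" "xs \<in> tuples (Dom A) n" for r n xs
    unfolding map[OF that(2)] using h(4)[OF that] .
qed

lemma iso_comp: "iso L h A B \<Longrightarrow> iso L k B C \<Longrightarrow> iso L (k \<circ> h) A C"
  unfolding iso_def by (metis embedding_comp image_comp)

lemma iso_cong: "is_structure L A \<Longrightarrow> iso L h A B \<Longrightarrow> (\<And>x. x \<in> Dom A \<Longrightarrow> h x = k x) \<Longrightarrow> iso L k A B"
  unfolding iso_def using embedding_cong[of L A h B k] by (auto cong: image_cong)

lemma iso_inv_into:
  assumes A: "is_structure L A" and h: "iso L h A B"
  shows "iso L (inv_into (Dom A) h) B A"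
proof -
  let ?i = "inv_into (Dom A) h"
  note h1 = embeddingD[OF conjunct1[OF h[unfolded iso_def]]]
    and h2 = conjunct2[OF h[unfolded iso_def]]
  have i: "?i (h x) = x" if "x \<in> Dom A" for x
    using h1(1) that by simp
  have im: "?i ` Dom B = Dom A"
    by (rule inv_into_image_cancel[OF h1(1), of "Dom A", unfolded h2]) simp
  have tup: "\<exists>ys. ys \<in> tuples (Dom A) n \<and> xs = map h ys \<and> map ?i xs = ys"
    if xs: "xs \<in> tuples (Dom B) n" for xs n
  proof -
    obtain ys where "ys \<in> tuples (Dom A) n" "xs = map h ys"
      using xs[folded h2] by (rule tuples_image)
    moreover then have "map ?i xs = ys"
      using i by (auto simp: tuples_def subset_iff intro!: map_idI)
    ultimately show ?thesis by blast
  qed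
  have "embedding L ?i B A"
  proof (rule embeddingI)
    show "inj_on ?i (Dom B)"
      using h2 by (simp add: inj_on_inv_into)
    show "?i ` Dom B \<subseteq> Dom A" using im by simp
    show "?i (Fun B f xs) = Fun A f (map ?i xs)"
      if f: "(f, n) \<in> Funs L" and xs: "xs \<in> tuples (Dom B) n" for f n xs
    proof -
      obtain ys where ys: "ys \<in> tuples (Dom A) n" "xs = map h ys" "map ?i xs = ys"
        using tup[OF xs] by blast
      have "Fun B f xs = h (Fun A f ys)"
        using h1(3)[OF f ys(1)] ys(2) by simp
      then show ?thesis
        using i[OF is_structureD[OF A f ys(1)]] ys(3) by simp
    qed
    show "Rel B r xs \<longleftrightarrow> Rel A r (map ?i xs)"
      if r: "(r, n) \<in> Rels L" and xs: "xs \<in> tuples (Dom B) n" for r n xs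
      using tup[OF xs] h1(4)[OF r] by auto
  qed
  with im show ?thesis by (simp add: iso_def)
qed

lemma closed_subset_embedding:
  assumes h: "embedding L h A B" and S: "closed_subset L A S"
  shows "closed_subset L B (h ` S)"
proof -
  note h = embeddingD[OF h]
  have "Fun B f xs \<in> h ` S" if f: "(f, n) \<in> Funs L" and xs: "xs \<in> tuples (h ` S) n" for f n xs
  proof -
    obtain ys where ys: "ys \<in> tuples S n" "xs = map h ys"
      using xs by (rule tuples_image)
    then have "Fun B f xs = h (Fun A f ys)"
      using h(3)[OF f tuples_mono[OF ys(1) closed_subset_subset[OF S]]] by simp
    then show ?thesis
      using closed_subsetD[OF S f ys(1)] by simp
  qed
  then show ?thesis
    using order_trans[OF image_mono[OF closed_subset_subset[OF S]] h(2)]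
    by (auto simp: closed_subset_def)
qed

lemma iso_induced:
  assumes h: "embedding L h A B" and S: "S \<subseteq> Dom A"
  shows "iso L h (induced A S) (induced B (h ` S))"
proof -
  note h = embeddingD[OF h]
  have "embedding L h (induced A S) (induced B (h ` S))"
    by (rule embeddingI) (use h(3,4) tuples_mono[OF _ S] inj_on_subset[OF h(1) S] in auto)
  then show ?thesis by (simp add: iso_def)
qed

lemma Aut_permutes: "h \<in> Aut L M \<Longrightarrow> h permutes Dom M"
  and Aut_embedding: "h \<in> Aut L M \<Longrightarrow> embedding L h M M"
  by (auto simp: Aut_def iso_def)

lemma Aut_image: "h \<in> Aut L M \<Longrightarrow> h ` Dom M = Dom M"
  by (auto simp: Aut_def iso_def)

lemma id_mem_Aut: "id \<in> Aut L M"
  by (simp add: Aut_def iso_def embedding_id)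

lemma comp_mem_Aut: "g \<in> Aut L M \<Longrightarrow> h \<in> Aut L M \<Longrightarrow> g \<circ> h \<in> Aut L M"
  by (auto simp: Aut_def intro: iso_comp permutes_compose)

lemma inv_mem_Aut:
  assumes M: "is_structure L M" and g: "g \<in> Aut L M"
  shows "inv g \<in> Aut L M"
proof -
  note p = Aut_permutes[OF g]
  have "inv_into (Dom M) g x = inv g x" if "x \<in> Dom M" for x
    by (metis p that permutes_image permutes_inverses(2) f_inv_into_f)
  moreover have "iso L (inv_into (Dom M) g) M M"
    using g by (intro iso_inv_into[OF M]) (simp add: Aut_def)
  ultimately have "iso L (inv g) M M"
    using iso_cong[OF M] by metis
  then show ?thesis
    using permutes_inv[OF p] by (simp add: Aut_def)
qed

text \<open>
  Copies of a rigid \<open>A\<close> are the same as embeddings of \<open>A\<close>, so a colouring of automorphisms by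
  their restrictions to \<open>A\<close> is a colouring of copies of \<open>A\<close>. A monochromatic copy of the
  structure generated by the translates of \<open>A\<close> is the image of that structure under the required
  automorphism.
\<close>

lemma ramsey_structure_coloring:
  fixes \<chi> :: "('a \<Rightarrow> 'a) \<Rightarrow> nat"
  assumes M: "ramsey_structure L M" and A\<^sub>0: "finite A\<^sub>0" "A\<^sub>0 \<subseteq> Dom M"
    and T: "finite T" "T \<subseteq> Aut L M" and fin: "finite (\<chi> ` Aut L M)"
    and \<chi>: "\<And>g h. g \<in> Aut L M \<Longrightarrow> h \<in> Aut L M \<Longrightarrow> (\<And>a. a \<in> A\<^sub>0 \<Longrightarrow> g a = h a) \<Longrightarrow> \<chi> g = \<chi> h"
  shows "\<exists>g\<in>Aut L M. \<forall>t\<in>T. \<chi> (g \<circ> t) = \<chi> g"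
proof -
  let ?G = "Aut L M"
  have str: "is_structure L M" and lf: "locally_finite L M"
    and hom: "\<And>S T f. finite S \<Longrightarrow> closed_subset L M S \<Longrightarrow> finite T \<Longrightarrow> closed_subset L M T \<Longrightarrow>
      iso L f (induced M S) (induced M T) \<Longrightarrow> \<exists>h\<in>?G. \<forall>x\<in>S. h x = f x"
    and ramsey: "ramsey_class L (age L M)" and rigid: "\<And>A. A \<in> age L M \<Longrightarrow> Aut L A = {id}"
    using M by (auto simp: ramsey_structure_def fraisse_structure_def)
  have in_age: "induced M S \<in> age L M" if "closed_subset L M S" "finite S" for S
  proof -
    have "embedding L id (induced M S) M"
      using that(1) closed_subset_subset by (intro embeddingI) fastforce+
    then show ?thesis
      using that is_structure_induced by (auto simp: age_def)
  qed
  \<comment> \<open>Homogeneity and rigidity concern substructures, so \<open>A\<^sub>0\<close> is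
    replaced by the substructure it generates, finite by local finiteness.\<close>
  define A where "A = closed_subset L M hull A\<^sub>0"
  have A: "closed_subset L M A" "finite A" "A\<^sub>0 \<subseteq> A"
    using closed_subset_hull[OF str A\<^sub>0(2)] lf A\<^sub>0
    by (simp_all add: A_def locally_finite_def hull_subset)
  note A = A closed_subset_subset[OF A(1)]
  have TA: "\<Union>((\<lambda>t. t ` A) ` insert id T) \<subseteq> Dom M"
  proof (intro UN_least)
    fix t assume "t \<in> insert id T"
    then have "t \<in> ?G" using T(2) id_mem_Aut by auto
    then show "t ` A \<subseteq> Dom M" using Aut_image A(4) by blast
  qed
  \<comment> \<open>Adding \<open>id\<close> to \<open>T\<close> puts \<open>A\<close> itself into
    \<open>B\<close>, so that the colour of \<open>g\<close> is compared with those of all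
    \<open>g \<circ> t\<close>.\<close>
  define B where "B = closed_subset L M hull \<Union>((\<lambda>t. t ` A) ` insert id T)"
  have "finite (\<Union>((\<lambda>t. t ` A) ` insert id T))"
    using A(2) T(1) by blast
  then have B: "closed_subset L M B" "finite B" "\<Union>((\<lambda>t. t ` A) ` insert id T) \<subseteq> B"
    using closed_subset_hull[OF str TA] lf TA
    unfolding B_def locally_finite_def by (simp_all only: hull_subset simp_thms)
  note B = B closed_subset_subset[OF B(1)]
  have AB: "A \<subseteq> B" and tB: "\<And>t. t \<in> T \<Longrightarrow> t ` A \<subseteq> B"
    using B(3) by auto
  let ?A = "induced M A" and ?B = "induced M B"
  \<comment> \<open>By homogeneity the isomorphism from \<open>?A\<close> onto the image of the copy
    \<open>S\<close> in \<open>M\<close> extends to an automorphism.\<close>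
  have copy: "\<exists>g\<in>?G. g ` A = e ` S"
    if C: "is_structure L C" "finite (Dom C)" and e: "embedding L e C M"
      and S: "S \<in> copies L C ?A" for C e S
  proof -
    obtain j where j: "iso L j ?A (induced C S)" and S: "closed_subset L C S"
      using S by (auto simp: copies_def isomorphic_def)
    have ej: "iso L (e \<circ> j) ?A (induced M (e ` S))"
      by (rule iso_comp[OF j iso_induced[OF e closed_subset_subset[OF S]]])
    have "finite S"
      using C(2) closed_subset_subset[OF S] by (rule rev_finite_subset)
    then obtain g where g: "g \<in> ?G" "\<forall>x\<in>A. g x = (e \<circ> j) x"
      using hom[OF A(2,1) _ closed_subset_embedding[OF e S] ej] by auto
    have "g ` A = (e \<circ> j) ` A"
      using g(2) by (intro image_cong) auto
    also have "\<dots> = e ` S"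
      using ej by (simp add: iso_def)
    finally show ?thesis using g(1) by blast
  qed
  \<comment> \<open>The map \<open>inv h \<circ> g\<close> restricts to an automorphism of the rigid
    structure \<open>?A\<close>; \<open>k\<close> extends this restriction by the identity, as
    \<open>Aut\<close> demands.\<close>
  have rigid_A: "g a = h a" if gh: "g \<in> ?G" "h \<in> ?G" "g ` A = h ` A" and "a \<in> A" for g h a
  proof -
    define k where "k x = (if x \<in> A then inv h (g x) else x)" for x
    have h': "inv h \<in> ?G" "inv h \<circ> h = id"
      using inv_mem_Aut[OF str gh(2)] permutes_inv_o(2)[OF Aut_permutes[OF gh(2)]] by auto
    have hgA: "(inv h \<circ> g) ` A = A"
      using gh(3) h'(2) by (metis image_comp image_id id_apply)
    have "embedding L (inv h \<circ> g) M M"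
      by (intro Aut_embedding comp_mem_Aut h' gh)
    from iso_induced[OF this A(4)] have "iso L (inv h \<circ> g) ?A ?A"
      by (simp only: hgA)
    then have iso: "iso L k ?A ?A"
      by (rule iso_cong[OF is_structure_induced[OF A(1)]]) (simp add: k_def)
    have "bij_betw k A A"
      using iso by (simp add: iso_def embedding_def bij_betw_def)
    then have "k permutes A"
      by (rule bij_imp_permutes) (simp add: k_def)
    with iso have "k \<in> Aut L ?A"
      by (simp add: Aut_def)
    then have "k = id"
      using rigid[OF in_age[OF A(1,2)]] by auto
    then have "inv h (g a) = a"
      using \<open>a \<in> A\<close> by (auto simp: k_def dest: fun_cong[of _ _ a])
    then show ?thesis
      using permutes_inverses(1)[OF Aut_permutes[OF gh(2)]] by metis
  qed
  obtain K where K: "\<And>g. g \<in> ?G \<Longrightarrow> \<chi> g < K"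
    using fin finite_nat_set_iff_bounded[of "\<chi> ` ?G"] by auto
  have "substructure L ?A ?B"
    using is_structure_induced A(1) B(1) AB
    by (auto simp: substructure_def intro!: embeddingI)
  then obtain C where C: "C \<in> age L M" and mono: "\<And>\<psi>. \<psi> ` copies L C ?A \<subseteq> {..<K} \<Longrightarrow>
      \<exists>B'\<in>copies L C ?B. \<exists>c. \<forall>S\<in>copies L (induced C B') ?A. \<psi> S = (c::nat)"
    using ramsey in_age[OF B(1,2)] unfolding ramsey_class_def by metis
  obtain e where e: "embedding L e C M" and C': "is_structure L C" "finite (Dom C)"
    using C by (auto simp: age_def)
  \<comment> \<open>A copy \<open>S\<close> gets the colour of any automorphism that carries
    \<open>A\<close> onto the image of \<open>S\<close> under \<open>e\<close>. By
    \<open>rigid_A\<close> all such automorphisms agree on \<open>A\<^sub>0\<close>, so the colour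
    is well defined.\<close>
  define \<psi> where "\<psi> S = \<chi> (SOME g. g \<in> ?G \<and> g ` A = e ` S)" for S
  have \<psi>: "\<psi> S = \<chi> g" if "g \<in> ?G" "g ` A = e ` S" for g S
  proof -
    let ?g = "SOME g. g \<in> ?G \<and> g ` A = e ` S"
    have g: "?g \<in> ?G \<and> ?g ` A = e ` S"
      using someI[of "\<lambda>g. g \<in> ?G \<and> g ` A = e ` S" g] that by blast
    have "\<chi> ?g = \<chi> g"
    proof (rule \<chi>)
      fix a assume "a \<in> A\<^sub>0"
      with A(3) have "a \<in> A" by blast
      then show "?g a = g a"
        using g that by (intro rigid_A) auto
    qed (use g that in auto)
    then show ?thesis by (simp add: \<psi>_def)
  qed
  have "\<psi> ` copies L C ?A \<subseteq> {..<K}"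
  proof (intro image_subsetI)
    fix S assume "S \<in> copies L C ?A"
    then obtain g where "g \<in> ?G" "g ` A = e ` S" using copy[OF C' e] by blast
    then show "\<psi> S \<in> {..<K}" using \<psi> K by simp
  qed
  from mono[OF this] obtain B' c where B': "B' \<in> copies L C ?B"
    and c: "\<And>S. S \<in> copies L (induced C B') ?A \<Longrightarrow> \<psi> S = c"
    by blast
  obtain j where j: "iso L j ?B (induced C B')" and B'cl: "closed_subset L C B'"
    using B' by (auto simp: copies_def isomorphic_def)
  note B'sub = closed_subset_subset[OF B'cl]
  have ej: "iso L (e \<circ> j) ?B (induced M (e ` B'))"
    by (rule iso_comp[OF j iso_induced[OF e B'sub]])
  have "finite B'"
    using C'(2) B'sub by (rule rev_finite_subset)
  \<comment> \<open>This \<open>g\<close> carries \<open>B\<close> onto the image in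
    \<open>M\<close> of the monochromatic copy, and each translate of \<open>A\<close> inside
    \<open>B\<close> onto the image of a copy of \<open>A\<close> with colour
    \<open>c\<close>.\<close>
  then obtain g where g: "g \<in> ?G" "\<And>x. x \<in> B \<Longrightarrow> g x = e (j x)"
    using hom[OF B(2,1) _ closed_subset_embedding[OF e B'cl] ej] by auto
  have "\<chi> (g \<circ> t) = c" if t: "t \<in> insert id T" for t
  proof -
    have tG: "t \<in> ?G" using t T(2) id_mem_Aut by auto
    have tA: "t ` A \<subseteq> B" using t AB tB by auto
    have tcl: "closed_subset L ?B (t ` A)"
      using closed_subset_embedding[OF Aut_embedding[OF tG] A(1)] closed_subset_induced[OF tA B(4)]
      by blast
    have j': "embedding L j ?B (induced C B')"
      using j by (simp add: iso_def)
    have "iso L j (induced ?B (t ` A)) (induced (induced C B') (j ` t ` A))"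
      by (rule iso_induced[OF j']) (simp add: tA)
    moreover have "iso L t ?A (induced ?B (t ` A))"
      using iso_induced[OF Aut_embedding[OF tG] A(4)] by (simp add: induced_def)
    ultimately have "isomorphic L ?A (induced (induced C B') (j ` t ` A))"
      unfolding isomorphic_def using iso_comp by blast
    then have "j ` t ` A \<in> copies L (induced C B') ?A"
      using closed_subset_embedding[OF j' tcl] by (simp add: copies_def)
    moreover have "(g \<circ> t) ` A = e ` j ` t ` A"
      using g(2) tA by (auto simp: image_image subset_iff)
    ultimately show ?thesis
      using c \<psi>[OF comp_mem_Aut[OF g(1) tG]] by metis
  qed
  then have "\<chi> (g \<circ> t) = c" "\<chi> (g \<circ> id) = c" if "t \<in> T" for t
    using that by blast+
  then show ?thesis
    using g(1) by auto
qed

section \<open>Automorphisms and definable sets\<close>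

lemma eval_tm_mem:
  assumes M: "is_structure L M"
  shows "wf_tm L t \<Longrightarrow> (\<And>i. i \<in> fv_tm t \<Longrightarrow> v i \<in> Dom M) \<Longrightarrow> eval_tm M v t \<in> Dom M"
proof (induction t)
  case (App f ts)
  have "eval_tm M v t \<in> Dom M" if "t \<in> set ts" for t
    using App.IH[OF that] App.prems that by (auto simp: list_all_iff)
  then have "map (eval_tm M v) ts \<in> tuples (Dom M) (length ts)"
    by (auto simp: tuples_def)
  from is_structureD[OF M _ this, of f] show ?case
    using App.prems(1) by simp
qed simp

lemma eval_tm_Aut:
  assumes M: "is_structure L M" and h: "h \<in> Aut L M"
  shows "wf_tm L t \<Longrightarrow> (\<And>i. i \<in> fv_tm t \<Longrightarrow> v i \<in> Dom M \<and> v' i = h (v i)) \<Longrightarrow>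
    eval_tm M v' t = h (eval_tm M v t)"
proof (induction t)
  case (App f ts)
  have "eval_tm M v t \<in> Dom M \<and> eval_tm M v' t = h (eval_tm M v t)" if "t \<in> set ts" for t
    using App.IH[OF that] App.prems that eval_tm_mem[OF M, of t v] by (auto simp: list_all_iff)
  then have ts: "map (eval_tm M v) ts \<in> tuples (Dom M) (length ts)"
    and map: "map (eval_tm M v') ts = map h (map (eval_tm M v) ts)"
    by (auto simp: tuples_def)
  show ?case
    using embeddingD(3)[OF Aut_embedding[OF h] _ ts, of f] App.prems(1) unfolding eval_tm.simps map
    by simp
qed simp

text \<open>The assignments are related at free variables only, because \<open>nth xs\<close> is
  unspecified beyond the length of \<open>xs\<close>.\<close>

lemma sat_Aut:
  assumes M: "is_structure L M" and h: "h \<in> Aut L M"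
  shows "wf_fm L \<phi> \<Longrightarrow> (\<And>i. i \<in> fv_fm \<phi> \<Longrightarrow> v i \<in> Dom M \<and> v' i = h (v i)) \<Longrightarrow>
    sat M v' \<phi> \<longleftrightarrow> sat M v \<phi>"
proof (induction \<phi> arbitrary: v v')
  case (Eq s t)
  then have "eval_tm M v' s = h (eval_tm M v s)" "eval_tm M v' t = h (eval_tm M v t)"
    "eval_tm M v s \<in> Dom M" "eval_tm M v t \<in> Dom M"
    by (auto intro!: eval_tm_Aut[OF M h] eval_tm_mem[OF M])
  then show ?case
    using embeddingD(1)[OF Aut_embedding[OF h]] by (auto dest: inj_onD)
next
  case (Atom r ts)
  have "eval_tm M v t \<in> Dom M \<and> eval_tm M v' t = h (eval_tm M v t)" if "t \<in> set ts" for t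
    using Atom that by (auto intro!: eval_tm_Aut[OF M h] eval_tm_mem[OF M] simp: list_all_iff)
  then have ts: "map (eval_tm M v) ts \<in> tuples (Dom M) (length ts)"
    and map: "map (eval_tm M v') ts = map h (map (eval_tm M v) ts)"
    by (auto simp: tuples_def)
  show ?case
    using embeddingD(4)[OF Aut_embedding[OF h] _ ts, of r] Atom.prems(1) unfolding sat.simps map
    by simp
next
  case (Neg \<phi>)
  then show ?case by simp
next
  case (Conj \<phi> \<psi>)
  then have "sat M v' \<phi> \<longleftrightarrow> sat M v \<phi>" "sat M v' \<psi> \<longleftrightarrow> sat M v \<psi>"
    by simp_all
  then show ?case by simp
next
  case (Ex i \<phi>)
  have eq: "sat M (v'(i := h a)) \<phi> \<longleftrightarrow> sat M (v(i := a)) \<phi>" if "a \<in> Dom M" for a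
    using that Ex.prems by (intro Ex.IH) auto
  have "(\<exists>b\<in>Dom M. sat M (v'(i := b)) \<phi>) \<longleftrightarrow> (\<exists>a\<in>Dom M. sat M (v'(i := h a)) \<phi>)"
    by (subst (1) Aut_image[OF h, symmetric]) simp
  then show ?case
    using eq by simp
qed

lemma definable_Aut:
  assumes M: "is_structure L M" and h: "h \<in> Aut L M" and R: "definable L M n R"
    and xs: "xs \<in> tuples (Dom M) n"
  shows "map h xs \<in> R \<longleftrightarrow> xs \<in> R"
proof -
  obtain \<phi> where \<phi>: "wf_fm L \<phi>" "fv_fm \<phi> \<subseteq> {..<n}" "R = {xs \<in> tuples (Dom M) n. sat M (nth xs) \<phi>}"
    using R by (auto simp: definable_def)
  have "sat M (nth (map h xs)) \<phi> \<longleftrightarrow> sat M (nth xs) \<phi>"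
    using xs \<phi>(2) by (intro sat_Aut[OF M h \<phi>(1)]) (auto simp: tuples_def subset_iff)
  moreover have "map h xs \<in> tuples (Dom M) n"
    using xs by (rule map_mem_tuples) (simp add: Aut_image[OF h])
  ultimately show ?thesis
    using xs \<phi>(3) by simp
qed

text \<open>The relations of \<open>N\<close> and the graphs of its functions are definable in
  \<open>N\<close>, hence in \<open>M\<close>, hence invariant under automorphisms of
  \<open>M\<close>.\<close>

lemma Aut_reduct:
  assumes "reduct L' N L M"
  shows "Aut L M \<subseteq> Aut L' N"
proof
  fix h assume h: "h \<in> Aut L M"
  have N: "is_structure L' N" and M: "is_structure L M" and Dom: "Dom N = Dom M"
    and def: "\<And>n R. definable L' N n R \<Longrightarrow> definable L M n R"
    using assms by (auto simp: reduct_def)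
  have inv: "map h xs \<in> R \<longleftrightarrow> xs \<in> R" if "definable L' N n R" "xs \<in> tuples (Dom N) n" for n R xs
    using definable_Aut[OF M h def[OF that(1)]] that(2) Dom by simp
  have "embedding L' h N N"
  proof (rule embeddingI)
    show "inj_on h (Dom N)" "h ` Dom N \<subseteq> Dom N"
      using embeddingD(1,2)[OF Aut_embedding[OF h]] Dom by simp_all
    show "h (Fun N f xs) = Fun N f (map h xs)"
      if f: "(f, n) \<in> Funs L'" and xs: "xs \<in> tuples (Dom N) n" for f n xs
    proof -
      \<comment> \<open>The formula for the graph of \<open>f\<close>: variable \<open>n\<close> is
        the value, the variables below \<open>n\<close> are the arguments.\<close>
      let ?\<phi> = "Eq (App f (map Var [0..<n])) (Var n)"
      let ?R = "{ys \<in> tuples (Dom N) (Suc n). sat N (nth ys) ?\<phi>}"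
      have "definable L' N (Suc n) ?R"
        unfolding definable_def using f by (intro exI[of _ ?\<phi>]) (auto simp: list_all_iff)
      moreover have "xs @ [Fun N f xs] \<in> tuples (Dom N) (Suc n)"
        using xs is_structureD[OF N f xs] by (auto simp: tuples_def)
      moreover have sat: "sat N (nth (ys @ [y])) ?\<phi> \<longleftrightarrow> Fun N f ys = y" if "length ys = n" for ys y
      proof -
        have "map ((!) (ys @ [y])) [0..<n] = ys"
          using that by (intro nth_equalityI) (auto simp: nth_append)
        moreover have "(ys @ [y]) ! n = y"
          using that by (simp add: nth_append)
        ultimately show ?thesis
          by (simp add: comp_def)
      qed
      moreover have "length xs = n"
        using xs by (simp add: tuples_def)
      ultimately have "map h (xs @ [Fun N f xs]) \<in> ?R"
        using inv by (metis (mono_tags, lifting) mem_Collect_eq)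
      then have "sat N (nth (map h xs @ [h (Fun N f xs)])) ?\<phi>"
        by (simp del: sat.simps)
      then show ?thesis
        using sat[of "map h xs"] \<open>length xs = n\<close> by (simp del: sat.simps)
    qed
    show "Rel N r xs \<longleftrightarrow> Rel N r (map h xs)"
      if r: "(r, n) \<in> Rels L'" and xs: "xs \<in> tuples (Dom N) n" for r n xs
    proof -
      let ?\<phi> = "Atom r (map Var [0..<n])"
      let ?R = "{ys \<in> tuples (Dom N) n. sat N (nth ys) ?\<phi>}"
      have "definable L' N n ?R"
        unfolding definable_def using r by (intro exI[of _ ?\<phi>]) (auto simp: list_all_iff)
      moreover have "ys \<in> ?R \<longleftrightarrow> Rel N r ys" if "ys \<in> tuples (Dom N) n" for ys
        using that map_nth[of ys] by (simp add: comp_def tuples_def)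
      moreover have "map h xs \<in> tuples (Dom N) n"
        using xs Aut_image[OF h] Dom by (intro map_mem_tuples) auto
      ultimately show ?thesis
        using inv[of n ?R xs] xs by blast
    qed
  qed
  then show "h \<in> Aut L' N"
    using h Dom by (simp add: Aut_def iso_def)
qed

section \<open>Imaginary elements\<close>

lemma im_act_id: "im_act id w = w"
  by (cases w) (simp add: im_act_def)

lemma im_act_comp: "im_act (g \<circ> h) w = im_act g (im_act h w)"
  by (cases w) (simp add: im_act_def image_image)

text \<open>The relation \<open>E\<close> is invariant because it is definable, so an automorphism
  carries the class of \<open>xs\<close> to the class of \<open>map h xs\<close>. Its effect on
  \<open>w\<close> can thus be read off a finite tuple, which yields supports and lets orbits be
  counted.\<close>

lemma imaginary_representative:
  assumes N: "is_structure L N" and w: "w \<in> imaginaries L N"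
  shows "\<exists>E n xs. xs \<in> tuples (Dom N) n \<and> (\<forall>h\<in>Aut L N. im_act h w = (E, E `` {map h xs}))"
proof -
  obtain E X n D where w': "w = (E, X)" and D: "definable L N n D" and E: "equiv D E"
    and def: "definable L N (2 * n) {xs @ ys | xs ys. (xs, ys) \<in> E}" (is "definable _ _ _ ?R")
    and X: "X \<in> D // E"
    using w by (auto simp: imaginaries_def)
  obtain xs where xs: "xs \<in> D" "X = E `` {xs}"
    using X by (rule quotientE)
  have D': "D \<subseteq> tuples (Dom N) n" using D by (auto simp: definable_def)
  have ED: "E \<subseteq> D \<times> D" using E by (simp add: equiv_def)
  \<comment> \<open>All members of \<open>D\<close> have length \<open>n\<close>, so a concatenation
    splits in only one way.\<close>
  have R: "ys @ zs \<in> ?R \<longleftrightarrow> (ys, zs) \<in> E"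
    if "ys \<in> tuples (Dom N) n" "zs \<in> tuples (Dom N) n" for ys zs
  proof
    assume "ys @ zs \<in> ?R"
    then obtain ys' zs' where "ys @ zs = ys' @ zs'" "(ys', zs') \<in> E" by blast
    moreover then have "length ys' = n"
      using ED D' by (auto simp: tuples_def)
    ultimately show "(ys, zs) \<in> E"
      using that by (simp add: tuples_def)
  qed blast
  have tup: "map h ys \<in> tuples (Dom N) n" if "h \<in> Aut L N" "ys \<in> tuples (Dom N) n" for h ys
    using that(2) by (rule map_mem_tuples) (simp add: Aut_image[OF that(1)])
  have inv: "(map h ys, map h zs) \<in> E \<longleftrightarrow> (ys, zs) \<in> E"
    if h: "h \<in> Aut L N" and yz: "ys \<in> tuples (Dom N) n" "zs \<in> tuples (Dom N) n" for h ys zs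
  proof -
    have "ys @ zs \<in> tuples (Dom N) (2 * n)"
      using yz by (auto simp: tuples_def)
    from definable_Aut[OF N h def this] have "map h ys @ map h zs \<in> ?R \<longleftrightarrow> ys @ zs \<in> ?R"
      by (simp only: map_append)
    then show ?thesis
      by (simp only: R[OF yz] R[OF tup[OF h yz(1)] tup[OF h yz(2)]])
  qed
  have "map h ` (E `` {xs}) = E `` {map h xs}" if h: "h \<in> Aut L N" for h
  proof (intro equalityI subsetI)
    fix zs assume "zs \<in> map h ` (E `` {xs})"
    then obtain ys where "zs = map h ys" "(xs, ys) \<in> E" by auto
    moreover then have "ys \<in> tuples (Dom N) n" using ED D' by auto
    ultimately show "zs \<in> E `` {map h xs}"
      using inv[OF h, of xs ys] xs(1) D' by auto
  next
    fix zs assume zs: "zs \<in> E `` {map h xs}"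
    then have "zs \<in> tuples (Dom N) n" using ED D' by auto
    then have "zs \<in> tuples (h ` Dom N) n" by (simp add: Aut_image[OF h])
    then obtain ys where ys: "ys \<in> tuples (Dom N) n" "zs = map h ys"
      by (rule tuples_image)
    then have "(xs, ys) \<in> E"
      using zs inv[OF h, of xs ys] xs(1) D' by auto
    then show "zs \<in> map h ` (E `` {xs})"
      using ys(2) by auto
  qed
  then have "\<forall>h\<in>Aut L N. im_act h w = (E, E `` {map h xs})"
    by (simp add: w' xs(2) im_act_def)
  then show ?thesis
    using xs(1) D' by blast
qed

lemma finite_image_factor:
  assumes "finite (f ` A)" and "\<And>x y. x \<in> A \<Longrightarrow> y \<in> A \<Longrightarrow> f x = f y \<Longrightarrow> g x = g y"
  shows "finite (g ` A)"
proof -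
  have "g x \<in> (\<lambda>k. g (SOME y. y \<in> A \<and> f y = k)) ` f ` A" if "x \<in> A" for x
  proof -
    have "(SOME y. y \<in> A \<and> f y = f x) \<in> A \<and> f (SOME y. y \<in> A \<and> f y = f x) = f x"
      using someI[of "\<lambda>y. y \<in> A \<and> f y = f x" x] that by blast
    then have "g x = g (SOME y. y \<in> A \<and> f y = f x)"
      using assms(2) that by metis
    then show ?thesis using that by blast
  qed
  then show ?thesis
    by (intro finite_subset[OF _ finite_imageI[OF assms(1)]]) blast
qed

lemma finite_union_of_orbits_closed:
  assumes W: "finite_union_of_orbits (Aut L N) W" and "h \<in> Aut L N" "w \<in> W"
  shows "im_act h w \<in> W"
proof -
  obtain T where W: "W = (\<Union>x\<in>T. {im_act h x | h. h \<in> Aut L N})"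
    using W by (auto simp: finite_union_of_orbits_def)
  then obtain x g where "x \<in> T" "g \<in> Aut L N" "w = im_act g x"
    using assms(3) by blast
  then have "im_act h w = im_act (h \<circ> g) x" "h \<circ> g \<in> Aut L N"
    using comp_mem_Aut[OF assms(2)] by (auto simp: im_act_comp)
  then show ?thesis
    using \<open>x \<in> T\<close> unfolding W by blast
qed

text \<open>
  An element \<open>im_act h x\<close> of \<open>W\<close> and a finite set listed by \<open>as\<close> are encoded by the tuple
  \<open>as @ map h xs\<close>, where \<open>xs\<close> represents the class \<open>x\<close>.
\<close>

lemma finite_stabiliser_orbits:
  assumes cat: "omega_categorical L M" and red: "reduct L' N L M"
    and W: "W \<subseteq> imaginaries L' N" "finite_union_of_orbits (Aut L' N) W"
    and A: "finite A" "A \<subseteq> Dom M"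
  shows "finite ((\<lambda>w. (\<lambda>g. im_act g w) ` {g \<in> Aut L M. \<forall>a\<in>A. g a = a}) ` W)"
proof -
  let ?G = "Aut L M" and ?H = "Aut L' N"
  have N: "is_structure L' N" and Dom: "Dom N = Dom M"
    using red by (auto simp: reduct_def)
  have GH: "?G \<subseteq> ?H" using Aut_reduct[OF red] .
  obtain T where T: "finite T" "W = (\<Union>x\<in>T. {im_act h x | h. h \<in> ?H})"
    using W(2) by (auto simp: finite_union_of_orbits_def)
  have "x \<in> W" if "x \<in> T" for x
    unfolding T(2) using that id_mem_Aut im_act_id[of x, symmetric] by blast
  then have "\<forall>x\<in>T. \<exists>E n xs. xs \<in> tuples (Dom N) n \<and> (\<forall>h\<in>?H. im_act h x = (E, E `` {map h xs}))"
    using imaginary_representative[OF N] W(1) by blast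
  then obtain E n xs where xs: "\<And>x. x \<in> T \<Longrightarrow> xs x \<in> tuples (Dom N) (n x)"
    and E: "\<And>x h. x \<in> T \<Longrightarrow> h \<in> ?H \<Longrightarrow> im_act h x = (E x, E x `` {map h (xs x)})"
    by metis
  obtain as where as: "set as = A" using finite_list[OF A(1)] by blast
  have "\<forall>w\<in>W. \<exists>x h. x \<in> T \<and> h \<in> ?H \<and> w = im_act h x"
    unfolding T(2) by blast
  then obtain x h where x: "\<And>w. w \<in> W \<Longrightarrow> x w \<in> T" and h: "\<And>w. w \<in> W \<Longrightarrow> h w \<in> ?H"
    and w: "\<And>w. w \<in> W \<Longrightarrow> w = im_act (h w) (x w)"
    by metis
  define t where "t w = as @ map (h w) (xs (x w))" for w
  \<comment> \<open>The orbit of \<open>w\<close> under the stabiliser of \<open>A\<close> is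
    determined by its index in \<open>T\<close> together with the \<open>?G\<close>-orbit of its
    code \<open>t w\<close>. \<omega>-categoricity leaves finitely many such pairs.\<close>
  define key where "key w = (x w, {map g (t w) | g. g \<in> ?G})" for w
  let ?O = "\<lambda>m. {{map g ys | g. g \<in> ?G} | ys. ys \<in> tuples (Dom M) m}"
  have "key w \<in> (SIGMA x:T. ?O (length as + n x))" if "w \<in> W" for w
  proof -
    have "map (h w) (xs (x w)) \<in> tuples (Dom M) (n (x w))"
      using xs[OF x[OF that]] Aut_image[OF h[OF that]] by (intro map_mem_tuples) (auto simp: Dom)
    then have "t w \<in> tuples (Dom M) (length as + n (x w))"
      using as A(2) by (auto simp: t_def tuples_def)
    then show ?thesis
      unfolding key_def using x[OF that] by blast
  qed
  moreover have "finite (SIGMA x:T. ?O (length as + n x))"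
    using T(1) cat by (intro finite_SigmaI) (auto simp: omega_categorical_def)
  ultimately have fin: "finite (key ` W)"
    by (meson finite_subset image_subsetI)
  let ?F = "\<lambda>w. (\<lambda>g. im_act g w) ` {g \<in> ?G. \<forall>a\<in>A. g a = a}"
  have sub: "?F w' \<subseteq> ?F w" if w_W: "w \<in> W" "w' \<in> W" and key: "key w = key w'" for w w'
  proof -
    have xx: "x w' = x w" and "{map g (t w) | g. g \<in> ?G} = {map g (t w') | g. g \<in> ?G}"
      using key by (auto simp: key_def)
    moreover have "t w' = map id (t w')" by simp
    ultimately have "t w' \<in> {map g (t w) | g. g \<in> ?G}"
      using id_mem_Aut by blast
    then obtain g where g: "g \<in> ?G" "t w' = map g (t w)" by blast
    \<comment> \<open>The equation between codes splits after \<open>as\<close>: the first part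
      makes \<open>g\<close> fix \<open>A\<close>, the second makes it carry \<open>w\<close> to
      \<open>w'\<close>.\<close>
    then have "map g as = as" and tail: "map (h w') (xs (x w)) = map (g \<circ> h w) (xs (x w))"
      using xx by (auto simp: t_def)
    then have fix_A: "\<forall>a\<in>A. g a = a"
      using as by (metis map_eq_conv list.map_id id_apply)
    have gh: "g \<circ> h w \<in> ?H"
      using comp_mem_Aut g(1) GH h[OF w_W(1)] by blast
    have "im_act g w = im_act (g \<circ> h w) (x w)"
      by (subst w[OF w_W(1)]) (simp only: im_act_comp)
    also have "\<dots> = im_act (h w') (x w')"
      using E[OF x[OF w_W(1)] gh] E[OF x[OF w_W(1)] h[OF w_W(2)]] tail xx by simp
    also have "\<dots> = w'" using w[OF w_W(2)] by simp
    finally have gw: "im_act g w = w'" .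
    show ?thesis
    proof (rule image_subsetI)
      fix u assume "u \<in> {g \<in> ?G. \<forall>a\<in>A. g a = a}"
      then have u: "u \<in> ?G" "\<forall>a\<in>A. u a = a" by auto
      have "im_act u w' = im_act (u \<circ> g) w"
        by (simp add: im_act_comp gw)
      moreover have "u \<circ> g \<in> {g \<in> ?G. \<forall>a\<in>A. g a = a}"
        using u fix_A comp_mem_Aut[OF u(1) g(1)] by simp
      ultimately show "im_act u w' \<in> ?F w" by blast
    qed
  qed
  show ?thesis
    using fin
  proof (rule finite_image_factor)
    fix w w' assume "w \<in> W" "w' \<in> W" "key w = key w'"
    then show "?F w = ?F w'"
      using sub[of w w'] sub[of w' w] by (simp only: subset_antisym)
  qed
qed

lemma ramsey_action_imaginaries:
  fixes M :: "('f, 'r, 'a) struct"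
  assumes cat: "omega_categorical L M" and M: "ramsey_structure L M" and red: "reduct L' N L M"
    and W: "W \<subseteq> imaginaries L' N" "finite_union_of_orbits (Aut L' N) W"
  shows "ramsey_action (Aut L M) (Dom M) W im_act"
proof
  have str: "is_structure L M" and N: "is_structure L' N" and Dom: "Dom N = Dom M"
    using red by (auto simp: reduct_def)
  note GH = Aut_reduct[OF red]
  show "\<exists>h\<in>Aut L M. h \<circ> g = id \<and> g \<circ> h = id" if "g \<in> Aut L M" for g
    using inv_mem_Aut[OF str that] permutes_inv_o[OF Aut_permutes[OF that]] by blast
  show "im_act g w \<in> W" if "g \<in> Aut L M" "w \<in> W" for g w
    using finite_union_of_orbits_closed[OF W(2)] GH that by blast
  show "\<exists>B. finite B \<and> B \<subseteq> Dom M \<and>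
      (\<forall>g\<in>Aut L M. \<forall>h\<in>Aut L M. (\<forall>b\<in>B. g b = h b) \<longrightarrow> im_act g w = im_act h w)" if w: "w \<in> W" for w
  proof -
    obtain E n xs where xs: "xs \<in> tuples (Dom N) n" "\<forall>h\<in>Aut L' N. im_act h w = (E, E `` {map h xs})"
      using imaginary_representative[OF N] W(1) w by blast
    have "im_act g w = im_act h w"
      if "g \<in> Aut L M" "h \<in> Aut L M" "\<forall>b\<in>set xs. g b = h b" for g h
    proof -
      have "map g xs = map h xs" using that(3) by simp
      with xs(2) that(1,2) GH show ?thesis by (metis subsetD)
    qed
    moreover have "finite (set xs)" "set xs \<subseteq> Dom M"
      using xs(1) Dom by (auto simp: tuples_def)
    ultimately show ?thesis by blast
  qed
  show "\<exists>g\<in>Aut L M. \<forall>t\<in>T. \<chi> (g \<circ> t) = \<chi> g"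
    if "finite A" "A \<subseteq> Dom M" "finite T" "T \<subseteq> Aut L M" "finite (\<chi> ` Aut L M)"
      "\<And>g h. g \<in> Aut L M \<Longrightarrow> h \<in> Aut L M \<Longrightarrow> (\<And>a. a \<in> A \<Longrightarrow> g a = h a) \<Longrightarrow> \<chi> g = \<chi> h"
    for A T and \<chi> :: "('a \<Rightarrow> 'a) \<Rightarrow> nat"
    using that by (rule ramsey_structure_coloring[OF M])
qed (simp_all add: id_mem_Aut comp_mem_Aut im_act_id im_act_comp
  finite_stabiliser_orbits[OF cat red W])

section \<open>Cyclic submodules and the construction of the chain\<close>

lemma FH_submodule_FW:
  assumes "\<And>h w. h \<in> H \<Longrightarrow> w \<in> W \<Longrightarrow> im_act h w \<in> W"
  shows "FH_submodule H W (FW W)"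
  using assms subspace_FW by (auto simp: FH_submodule_def intro!: lin_ext_mem_FW)

text \<open>\<open>FW W\<close> is one of the submodules containing \<open>v\<close>, which keeps
  their intersection inside \<open>FW W\<close>.\<close>

lemma FH_submodule_hull:
  assumes "\<And>h w. h \<in> H \<Longrightarrow> w \<in> W \<Longrightarrow> im_act h w \<in> W" and "v \<in> FW W"
  shows "FH_submodule H W (FH_submodule H W hull {v})"
proof -
  have FW: "FH_submodule H W (FW W)"
    using assms(1) by (rule FH_submodule_FW)
  have "FH_submodule H W hull {v} \<subseteq> FW W"
    using FW assms(2) by (intro hull_minimal) auto
  then show ?thesis
    unfolding FH_submodule_def[of H W "_ hull _"]
    by (auto simp: hull_def FH_submodule_def poly.subspace_def)
qed

theorem corollary3p9:
  fixes L :: "('f, 'r) signature" and M :: "('f, 'r, 'a) struct"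
    and L' :: "('g, 's) signature" and N :: "('g, 's, 'a) struct"
    and H :: "('a \<Rightarrow> 'a) set" and W :: "'a imaginary set"
  assumes "omega_categorical L M"
    and "ramsey_structure L M"
    and "reduct L' N L M"
    and "H = Aut L' N"
    and "W \<subseteq> imaginaries L' N"
    and "finite_union_of_orbits H W"
    and "\<not> ascending_chain_condition
            (FH_submodule H W :: ('a imaginary \<Rightarrow>\<^sub>0 'k::field) set \<Rightarrow> bool)"
  shows "\<exists>X :: nat \<Rightarrow> ('a imaginary \<Rightarrow>\<^sub>0 'k) set.
           (\<forall>i. cyclic_FH_submodule H W (X i)) \<and> (\<forall>i. X i \<subset> X (Suc i))"
proof -
  interpret ramsey_action "Aut L M" "Dom M" W im_act
    using assms(1-6) by (intro ramsey_action_imaginaries) auto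
  have GH: "Aut L M \<subseteq> H"
    using Aut_reduct[OF assms(3)] assms(4) by simp
  have HW: "im_act h w \<in> W" if "h \<in> H" "w \<in> W" for h w
    using finite_union_of_orbits_closed assms(4,6) that by blast
  have "\<exists>X :: nat \<Rightarrow> ('a imaginary \<Rightarrow>\<^sub>0 'k) set. (\<forall>i. FH_submodule H W (X i)) \<and>
      (\<forall>i. X i \<subseteq> X (Suc i)) \<and> (\<forall>m. \<exists>n\<ge>m. X n \<noteq> X m)"
    using assms(7) by (simp add: ascending_chain_condition_def)
  then obtain X :: "nat \<Rightarrow> ('a imaginary \<Rightarrow>\<^sub>0 'k) set" where X: "\<And>i. FH_submodule H W (X i)"
    and X_Suc: "\<And>i. X i \<subseteq> X (Suc i)" and strict: "\<And>m. \<exists>n\<ge>m. X n \<noteq> X m"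
    by metis
  have mono: "X i \<subseteq> X j" if "i \<le> j" for i j
    using that X_Suc by (rule lift_Suc_mono_le[rotated])
  have X': "X i \<subseteq> FW W" "poly.subspace (X i)"
    "\<And>h v. h \<in> H \<Longrightarrow> v \<in> X i \<Longrightarrow> lin_ext (im_act h) v \<in> X i" for i
    using X[of i] by (auto simp: FH_submodule_def)
  obtain m\<^sub>0 where m\<^sub>0: "\<And>m. m \<ge> m\<^sub>0 \<Longrightarrow> \<exists>n\<ge>m. \<exists>v\<in>X n. v \<notin> X m \<and> lin_ext (rep {}) v = 0"
    using strict_chain_grows_in_kernel[of X, OF X'(2,1) mono strict] by blast
  define Y where "Y v = FH_submodule H W hull {v}" for v :: "'a imaginary \<Rightarrow>\<^sub>0 'k"
  have Y: "FH_submodule H W (Y v)" if "v \<in> FW W" for v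
    unfolding Y_def using HW that by (rule FH_submodule_hull)
  have Y_min: "Y v \<subseteq> Z" if "FH_submodule H W Z" "v \<in> Z" for v Z
    unfolding Y_def using that by (intro hull_minimal) auto
  \<comment> \<open>A state is a pair of a generator and an index \<open>m\<close> from
    \<open>m\<^sub>0\<close> on such that \<open>X m\<close> contains the generator. The index
    records where the next vector has to be new.\<close>
  have "\<exists>s. \<forall>k. (fst (s k) \<in> X (snd (s k)) \<and> snd (s k) \<ge> m\<^sub>0) \<and> Y (fst (s k)) \<subset> Y (fst (s (Suc k)))"
  proof (rule dependent_nat_choice)
    show "\<exists>p. fst p \<in> X (snd p) \<and> snd p \<ge> m\<^sub>0"
      using poly.subspace_0[OF X'(2)[of m\<^sub>0]] by (intro exI[of _ "(0, m\<^sub>0)"]) simp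
    fix p :: "('a imaginary \<Rightarrow>\<^sub>0 'k) \<times> nat" and k :: nat
    assume p: "fst p \<in> X (snd p) \<and> snd p \<ge> m\<^sub>0"
    define u m where "u = fst p" and "m = snd p"
    have u: "u \<in> X m" and m: "m \<ge> m\<^sub>0" using p by (auto simp: u_def m_def)
    obtain n v where n: "n \<ge> m" and v: "v \<in> X n" "v \<notin> X m" "lin_ext (rep {}) v = 0"
      using m\<^sub>0[OF m] by blast
    have uFW: "u \<in> FW W" and vFW: "v \<in> FW W"
      using u v X'(1) by auto
    obtain g where g: "g \<in> Aut L M" and gen: "\<forall>Z. poly.subspace Z \<and>
        (\<forall>h\<in>Aut L M. \<forall>x\<in>Z. lin_ext (im_act h) x \<in> Z) \<and>
        u + lin_ext (im_act g) v \<in> Z \<longrightarrow> u \<in> Z \<and> v \<in> Z"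
      using combine_generators[OF uFW vFW v(3)] by (rule bexE)
    define u' where "u' = u + lin_ext (im_act g) v"
    have u'X: "u' \<in> X n"
      unfolding u'_def using u v(1) mono[OF n] g GH
      by (intro poly.subspace_add X'(2,3)) auto
    then have YY: "FH_submodule H W (Y u')"
      using X'(1) by (intro Y) auto
    have "u \<in> Y u' \<and> v \<in> Y u'"
    proof (rule gen[rule_format, OF conjI[OF _ conjI]])
      show "u + lin_ext (im_act g) v \<in> Y u'"
        by (simp add: Y_def u'_def hull_inc)
    qed (use YY GH in \<open>auto simp: FH_submodule_def\<close>)
    \<comment> \<open>All of \<open>Y u\<close> lies in \<open>X m\<close>, which \<open>v\<close>
      avoids; this makes the inclusion strict.\<close>
    moreover have "v \<notin> Y u"
      using Y_min[OF X u] v(2) by blast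
    ultimately have "Y u \<subset> Y u'"
      using Y_min[OF YY] by blast
    then show "\<exists>p'. (fst p' \<in> X (snd p') \<and> snd p' \<ge> m\<^sub>0) \<and> Y (fst p) \<subset> Y (fst p')"
      using u'X n m by (intro exI[of _ "(u', n)"]) (auto simp: u_def)
  qed
  then obtain s where s: "\<And>k. fst (s k) \<in> X (snd (s k))" "\<And>k. Y (fst (s k)) \<subset> Y (fst (s (Suc k)))"
    by blast
  have "cyclic_FH_submodule H W (Y (fst (s k)))" for k
    using Y[of "fst (s k)"] s(1)[of k] X'(1) unfolding cyclic_FH_submodule_def Y_def by blast
  then show ?thesis
    using s(2) by (intro exI[of _ "\<lambda>k. Y (fst (s k))"]) blast
qed

end
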